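(* Let $\Omega\subset\mathbb H^n$ be an open, bounded and $H$-convex set, and let $u,v:\overline\Omega\to\mathbb R$ be continuous $H$-convex functions. If for every Borel set $E\subset\Omega$ we have $\mathcal L^{2n}(\partial_Hv(E))\le\mathcal L^{2n}(\partial_Hu(E))$, then $\min_{\xi\in\overline\Omega}(v(\xi)-u(\xi))=\min_{\xi\in\partial\Omega}(v(\xi)-u(\xi))$.
   Context: $\mathbb H^n=\mathbb C^n\times\mathbb R\cong\mathbb R^{2n+1}$ with real coordinates $(x,y,t)$, $z=x+iy$, and group law $(z,t)\circ(z',t')=(z+z',t+t'+2\,\mathrm{Im}\langle z,z'\rangle)$, $\langle z,z'\rangle=\sum_j z_j\overline{z'_j}$. Dilations $\delta_\lambda(z,t)=(\lambda z,\lambda^2t)$. Horizontal plane at $\xi_0=(x_0,y_0,t_0)$: $H_{\xi_0}=\{(x,y,t):t=t_0+2(x\cdot y_0-x_0\cdot y)\}$. $\mathrm{Pr}_1(x,y,t)=(x,y)$. A set $\tilde\Omega$ is $H$-convex if for all $\xi_1,\xi_2\in\tilde\Omega$ with $\xi_1\in H_{\xi_2}$ and $\lambda\in[0,1]$, $\xi_1\circ\delta_\lambda(\xi_1^{-1}\circ\xi_2)\in\tilde\Omega$; a function $u$ on $\tilde\Omega$ is $H$-convex if for all such $\xi_1,\xi_2,\lambda$, $u(\xi_1\circ\delta_\lambda(\xi_1^{-1}\circ\xi_2))\le(1-\lambda)u(\xi_1)+\lambda u(\xi_2)$. For $u$ defined on $\overline\Omega$ and $\xi_0\in\Omega$, $\partial_Hu(\xi_0)=\{p\in\mathbb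 R^{2n}:u(\xi)\ge u(\xi_0)+p\cdot(\mathrm{Pr}_1(\xi)-\mathrm{Pr}_1(\xi_0))\ \forall\xi\in\Omega\cap H_{\xi_0}\}$ and $\partial_Hu(E)=\bigcup_{\xi\in E}\partial_Hu(\xi)$. $\mathcal L^{2n}$ is Lebesgue measure on $\mathbb R^{2n}$. *)

theory Defs
  imports "HOL-Analysis.Analysis"
begin

text \<open>Heisenberg group H^n = C^n x R, a point (x,y,t) with z = x + i y,
  x, y :: real^'n (the index type 'n has n elements).\<close>

type_synonym 'n heis = "(real^'n) \<times> (real^'n) \<times> real"

definition heis_mult :: "'n::finite heis \<Rightarrow> 'n heis \<Rightarrow> 'n heis" (infixl "\<circ>\<^sub>H" 70) where
  "heis_mult a b = (case a of (x, y, t) \<Rightarrow> case b of (x', y', t') \<Rightarrow>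
     (x + x', y + y', t + t' + 2 * (y \<bullet> x' - x \<bullet> y')))"
  \<comment> \<open>Im <z,z'> = sum_j (y_j x'_j - x_j y'_j)\<close>

definition heis_inv :: "'n::finite heis \<Rightarrow> 'n heis" where
  "heis_inv a = (case a of (x, y, t) \<Rightarrow> (-x, -y, -t))"

definition heis_dil :: "real \<Rightarrow> 'n::finite heis \<Rightarrow> 'n heis" where
  "heis_dil r a = (case a of (x, y, t) \<Rightarrow> (r *\<^sub>R x, r *\<^sub>R y, r\<^sup>2 * t))"

definition horiz_plane :: "'n::finite heis \<Rightarrow> 'n heis set" where
  "horiz_plane \<xi>0 = (case \<xi>0 of (x0, y0, t0) \<Rightarrow>
     {(x, y, t). t = t0 + 2 * (x \<bullet> y0 - x0 \<bullet> y)})"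

definition Pr1 :: "'n::finite heis \<Rightarrow> (real^'n) \<times> (real^'n)" where
  "Pr1 a = (case a of (x, y, t) \<Rightarrow> (x, y))"

definition H_convex_set :: "'n::finite heis set \<Rightarrow> bool" where
  "H_convex_set S \<longleftrightarrow> (\<forall>\<xi>1\<in>S. \<forall>\<xi>2\<in>S. \<forall>r::real. \<xi>1 \<in> horiz_plane \<xi>2 \<and> 0 \<le> r \<and> r \<le> 1 \<longrightarrow>
      \<xi>1 \<circ>\<^sub>H heis_dil r (heis_inv \<xi>1 \<circ>\<^sub>H \<xi>2) \<in> S)"

definition H_convex_fun :: "'n::finite heis set \<Rightarrow> ('n heis \<Rightarrow> real) \<Rightarrow> bool" where
  "H_convex_fun S u \<longleftrightarrow> (\<forall>\<xi>1\<in>S. \<forall>\<xi>2\<in>S. \<forall>r::real. \<xi>1 \<in> horiz_plane \<xi>2 \<and> 0 \<le> r \<and> r \<le> 1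
      \<and> \<xi>1 \<circ>\<^sub>H heis_dil r (heis_inv \<xi>1 \<circ>\<^sub>H \<xi>2) \<in> S \<longrightarrow>
      u (\<xi>1 \<circ>\<^sub>H heis_dil r (heis_inv \<xi>1 \<circ>\<^sub>H \<xi>2)) \<le> (1 - r) * u \<xi>1 + r * u \<xi>2)"

definition H_subdiff :: "'n::finite heis set \<Rightarrow> ('n heis \<Rightarrow> real) \<Rightarrow> 'n heis \<Rightarrow> ((real^'n) \<times> (real^'n)) set" where
  "H_subdiff \<Omega> u \<xi>0 = {p. \<forall>\<xi>\<in>\<Omega> \<inter> horiz_plane \<xi>0. u \<xi> \<ge> u \<xi>0 + p \<bullet> (Pr1 \<xi> - Pr1 \<xi>0)}"

definition H_subdiff_set :: "'n::finite heis set \<Rightarrow> ('n heis \<Rightarrow> real) \<Rightarrow> 'n heis set \<Rightarrow> ((real^'n) \<times> (real^'n)) set" where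
  "H_subdiff_set \<Omega> u E = (\<Union>\<xi>\<in>E. H_subdiff \<Omega> u \<xi>)"

end

theory Submission
  imports Defs
begin

text \<open>
  Suppose the minimum \<open>m\<close> of \<open>v - u\<close> on the closure is smaller than its minimum \<open>M\<close> on the frontier.
  Put \<open>w = (1 + \<epsilon>) u + (m + M) / 2\<close> with small \<open>\<epsilon> > 0\<close>; then \<open>G = {v < w}\<close> is a nonempty open set
  compactly contained in \<open>\<Omega>\<close>. A degree argument in the horizontal plane at a point \<open>\<xi>\<close> of \<open>G\<close> shows
  that a neighbourhood of every horizontal subgradient of \<open>w\<close> at \<open>\<xi>\<close> consists of horizontal
  subgradients of \<open>v\<close> at points of \<open>G\<close>. Hence \<open>(1 + \<epsilon>) \<partial>\<^sub>Hu(G) \<subseteq> \<partial>\<^sub>Hv(G)\<close>, so that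
  \<open>(1 + \<epsilon>)\<^sup>2\<^sup>n |\<partial>\<^sub>Hu(G)| \<le> |\<partial>\<^sub>Hv(G)| \<le> |\<partial>\<^sub>Hu(G)| < \<infinity>\<close> and all these measures vanish, although
  \<open>\<partial>\<^sub>Hv(G)\<close> contains a ball.
\<close>

section \<open>Horizontal planes\<close>

text \<open>The point of the horizontal plane at \<open>\<xi>\<close> lying above \<open>z\<close>.\<close>

definition hlift :: "'n::finite heis \<Rightarrow> (real^'n) \<times> (real^'n) \<Rightarrow> 'n heis" where
  "hlift \<xi> z = (fst z, snd z, snd (snd \<xi>) + 2 * (fst z \<bullet> fst (snd \<xi>) - fst \<xi> \<bullet> snd z))"

lemma Pr1_eq: "Pr1 \<xi> = (fst \<xi>, fst (snd \<xi>))"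
  by (cases \<xi>) (simp add: Pr1_def)

lemma Pr1_hlift [simp]: "Pr1 (hlift \<xi> z) = z"
  by (simp add: Pr1_eq hlift_def)

lemma hlift_self [simp]: "hlift \<xi> (Pr1 \<xi>) = \<xi>"
  by (cases \<xi>) (simp add: hlift_def Pr1_def)

lemma horiz_plane_iff: "\<eta> \<in> horiz_plane \<xi> \<longleftrightarrow> hlift \<xi> (Pr1 \<eta>) = \<eta>"
  by (cases \<xi>; cases \<eta>) (auto simp: horiz_plane_def hlift_def Pr1_def)

lemma hlift_in_plane [simp]: "hlift \<xi> z \<in> horiz_plane \<xi>"
  by (simp add: horiz_plane_iff)

lemma horiz_plane_sym: "\<eta> \<in> horiz_plane \<xi> \<longleftrightarrow> \<xi> \<in> horiz_plane \<eta>"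
  by (cases \<xi>; cases \<eta>) (auto simp: horiz_plane_def inner_commute)

lemma continuous_hlift [continuous_intros]:
  assumes "continuous_on S f" "continuous_on S g"
  shows "continuous_on S (\<lambda>x. hlift (f x) (g x))"
  unfolding hlift_def by (intro continuous_intros assms)

lemma continuous_heis_mult [continuous_intros]:
  assumes "continuous_on S f" "continuous_on S g"
  shows "continuous_on S (\<lambda>x. f x \<circ>\<^sub>H g x)"
  unfolding heis_mult_def case_prod_unfold by (intro continuous_intros assms)

lemma continuous_heis_inv [continuous_intros]:
  assumes "continuous_on S f"
  shows "continuous_on S (\<lambda>x. heis_inv (f x))"
  unfolding heis_inv_def case_prod_unfold by (intro continuous_intros assms)

lemma continuous_Pr1 [continuous_intros]:
  assumes "continuous_on S f"
  shows "continuous_on S (\<lambda>x. Pr1 (f x))"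
  unfolding Pr1_eq by (intro continuous_intros assms)

lemma heis_mult_inv_right [simp]: "(a \<circ>\<^sub>H b) \<circ>\<^sub>H heis_inv b = a"
  by (cases a; cases b) (simp add: heis_mult_def heis_inv_def algebra_simps inner_commute)

lemma heis_mult_inv_right' [simp]: "(a \<circ>\<^sub>H heis_inv b) \<circ>\<^sub>H b = a"
  by (cases a; cases b) (simp add: heis_mult_def heis_inv_def algebra_simps inner_commute)

lemma heis_mult_0 [simp]: "0 \<circ>\<^sub>H b = b"
  by (cases b) (simp add: heis_mult_def zero_prod_def)

text \<open>Horizontality is the vanishing of the last coordinate of
  \<open>heis_inv \<xi> \<circ>\<^sub>H \<eta>\<close>, so the dilation acts linearly on this
  element and the group segment becomes a straight one.\<close>

lemma horizontal_segment:
  assumes "\<xi> \<in> horiz_plane \<eta>"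
  shows "\<xi> \<circ>\<^sub>H heis_dil r (heis_inv \<xi> \<circ>\<^sub>H \<eta>) = \<xi> + r *\<^sub>R (\<eta> - \<xi>)"
  using assms
  by (cases \<xi>; cases \<eta>; clarsimp simp: horiz_plane_def)
     (simp add: heis_mult_def heis_inv_def heis_dil_def algebra_simps inner_commute)

text \<open>Horizontality depends only on \<open>heis_inv \<xi> \<circ>\<^sub>H \<eta>\<close>,
  which a left translation of both points leaves unchanged. As left translations are also affine,
  they carry horizontal segments to horizontal segments.\<close>

lemma heis_mult_horiz_plane:
  assumes "\<eta> \<in> horiz_plane \<xi>"
  shows "a \<circ>\<^sub>H \<eta> \<in> horiz_plane (a \<circ>\<^sub>H \<xi>)"
  using assms
  by (cases \<xi>; cases \<eta>; cases a)
     (simp add: horiz_plane_def heis_mult_def algebra_simps inner_commute)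

lemma heis_mult_segment:
  "a \<circ>\<^sub>H (\<xi> + r *\<^sub>R (\<eta> - \<xi>)) = a \<circ>\<^sub>H \<xi> + r *\<^sub>R (a \<circ>\<^sub>H \<eta> - a \<circ>\<^sub>H \<xi>)"
  by (cases \<xi>; cases \<eta>; cases a) (simp add: heis_mult_def algebra_simps)

text \<open>H-convexity of \<Omega> places the intermediate point in \<Omega>, which discharges the
  membership condition inside \<open>H_convex_fun\<close>.\<close>

lemma H_convex_fun_segment:
  assumes "H_convex_set \<Omega>" "H_convex_fun (closure \<Omega>) g"
    and "\<xi> \<in> \<Omega>" "\<eta> \<in> \<Omega>" "\<eta> \<in> horiz_plane \<xi>" "0 \<le> r" "r \<le> 1"
  shows "g (\<xi> + r *\<^sub>R (\<eta> - \<xi>)) \<le> g \<xi> + r * (g \<eta> - g \<xi>)"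
proof -
  have h: "\<xi> \<in> horiz_plane \<eta>" using assms horiz_plane_sym by blast
  have "\<xi> \<circ>\<^sub>H heis_dil r (heis_inv \<xi> \<circ>\<^sub>H \<eta>) \<in> \<Omega>"
    using assms h unfolding H_convex_set_def by blast
  then have "g (\<xi> \<circ>\<^sub>H heis_dil r (heis_inv \<xi> \<circ>\<^sub>H \<eta>)) \<le> (1 - r) * g \<xi> + r * g \<eta>"
    using assms h closure_subset unfolding H_convex_fun_def by blast
  then show ?thesis by (simp add: horizontal_segment[OF h] algebra_simps)
qed

section \<open>Mollification by left translations\<close>

lemma nn_integral_lborel_translate:
  fixes f :: "'a::euclidean_space \<Rightarrow> ennreal"
  assumes "f \<in> borel_measurable borel"
  shows "(\<integral>\<^sup>+x. f (x + c) \<partial>lborel) = (\<integral>\<^sup>+x. f x \<partial>lborel)"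
proof -
  have "(\<integral>\<^sup>+x. f x \<partial>lborel) = (\<integral>\<^sup>+x. f x \<partial>distr lborel borel ((+) c))"
    by (simp add: lborel_distr_plus)
  also have "\<dots> = (\<integral>\<^sup>+x. f (c + x) \<partial>lborel)"
    using assms by (subst nn_integral_distr) auto
  finally show ?thesis by (simp add: add.commute)
qed

lemma measurable_heis_mult_right [measurable]:
  "(\<lambda>a. a \<circ>\<^sub>H b) \<in> borel_measurable borel"
  by (intro borel_measurable_continuous_onI continuous_intros)

text \<open>A right translation shifts x and y by constants and t by an amount depending only on x
  and y. With t integrated first, then y, then x, each shift is constant in its own
  variable.\<close>

lemma lborel_distr_heis_mult_right:
  "distr lborel borel (\<lambda>a. a \<circ>\<^sub>H b) = (lborel :: 'n::finite heis measure)"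
proof (rule measure_eqI)
  fix A :: "'n heis set"
  assume "A \<in> sets (distr lborel borel (\<lambda>a. a \<circ>\<^sub>H b))"
  then have A [measurable]: "A \<in> sets borel" by simp
  obtain x' y' t' where b: "b = (x', y', t')" by (cases b)
  define F :: "'n heis \<Rightarrow> ennreal" where "F = indicator A"
  have F: "F \<in> borel_measurable borel" by (simp add: F_def)
  have prod: "(\<integral>\<^sup>+a. H a \<partial>lborel) = (\<integral>\<^sup>+x. (\<integral>\<^sup>+y. (\<integral>\<^sup>+t. H (x, y, t) \<partial>lborel) \<partial>lborel) \<partial>lborel)"
    if H: "H \<in> borel_measurable borel" for H :: "'n heis \<Rightarrow> ennreal"
  proof -
    have H1: "H \<in> borel_measurable (lborel \<Otimes>\<^sub>M lborel)"
      using H by (simp add: lborel_prod)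
    have H2: "(\<lambda>w. H (x, w)) \<in> borel_measurable (lborel \<Otimes>\<^sub>M lborel)" for x
      using H1 by (simp add: lborel_prod)
    have "(\<integral>\<^sup>+a. H a \<partial>lborel) = (\<integral>\<^sup>+a. H a \<partial>(lborel \<Otimes>\<^sub>M lborel))"
      by (simp add: lborel_prod)
    also have "\<dots> = (\<integral>\<^sup>+x. (\<integral>\<^sup>+w. H (x, w) \<partial>lborel) \<partial>lborel)"
      by (rule lborel.nn_integral_fst[symmetric, OF H1])
    also have "\<dots> = (\<integral>\<^sup>+x. (\<integral>\<^sup>+w. H (x, w) \<partial>(lborel \<Otimes>\<^sub>M lborel)) \<partial>lborel)"
      by (simp add: lborel_prod)
    also have "\<dots> = (\<integral>\<^sup>+x. (\<integral>\<^sup>+y. (\<integral>\<^sup>+t. H (x, y, t) \<partial>lborel) \<partial>lborel) \<partial>lborel)"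
      by (simp add: lborel.nn_integral_fst[symmetric, OF H2])
    finally show ?thesis .
  qed
  have "emeasure (distr lborel borel (\<lambda>a. a \<circ>\<^sub>H b)) A = (\<integral>\<^sup>+a. F a \<partial>distr lborel borel (\<lambda>a. a \<circ>\<^sub>H b))"
    by (simp add: F_def)
  also have "\<dots> = (\<integral>\<^sup>+a. F (a \<circ>\<^sub>H b) \<partial>lborel)"
    by (rule nn_integral_distr) (use F in auto)
  also have "\<dots> = (\<integral>\<^sup>+x. (\<integral>\<^sup>+y. (\<integral>\<^sup>+t. F ((x, y, t) \<circ>\<^sub>H b) \<partial>lborel) \<partial>lborel) \<partial>lborel)"
    by (rule prod) (use F in measurable)
  also have "\<dots> = (\<integral>\<^sup>+x. (\<integral>\<^sup>+y. (\<integral>\<^sup>+t. F (x + x', y + y', t + (t' + 2 * (y \<bullet> x' - x \<bullet> y'))) \<partial>lborel) \<partial>lborel) \<partial>lborel)"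
    by (simp add: b heis_mult_def add.assoc)
  also have "\<dots> = (\<integral>\<^sup>+x. (\<integral>\<^sup>+y. (\<integral>\<^sup>+t. F (x + x', y + y', t) \<partial>lborel) \<partial>lborel) \<partial>lborel)"
    by (subst nn_integral_lborel_translate) (use F in auto)
  also have "\<dots> = (\<integral>\<^sup>+x. (\<integral>\<^sup>+y. (\<integral>\<^sup>+t. F (x + x', y, t) \<partial>lborel) \<partial>lborel) \<partial>lborel)"
    by (subst nn_integral_lborel_translate[where f = "\<lambda>y. \<integral>\<^sup>+t. F (_, y, t) \<partial>lborel"]) (use F in auto)
  also have "\<dots> = (\<integral>\<^sup>+x. (\<integral>\<^sup>+y. (\<integral>\<^sup>+t. F (x, y, t) \<partial>lborel) \<partial>lborel) \<partial>lborel)"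
    by (subst nn_integral_lborel_translate[where f = "\<lambda>x. \<integral>\<^sup>+y. \<integral>\<^sup>+t. F (x, y, t) \<partial>lborel \<partial>lborel"]) (use F in auto)
  also have "\<dots> = (\<integral>\<^sup>+a. F a \<partial>lborel)"
    using prod[OF F] by simp
  also have "\<dots> = emeasure lborel A"
    by (simp add: F_def)
  finally show "emeasure (distr lborel borel (\<lambda>a. a \<circ>\<^sub>H b)) A = emeasure lborel A" .
qed simp

lemma integral_heis_mult_right:
  fixes h :: "'n::finite heis \<Rightarrow> real"
  assumes "h \<in> borel_measurable borel"
  shows "(\<integral>a. h (a \<circ>\<^sub>H b) \<partial>lborel) = (\<integral>a. h a \<partial>lborel)"
proof -
  have "(\<integral>a. h a \<partial>lborel) = (\<integral>a. h a \<partial>distr lborel borel (\<lambda>a. a \<circ>\<^sub>H b))"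
    by (simp add: lborel_distr_heis_mult_right)
  also have "\<dots> = (\<integral>a. h (a \<circ>\<^sub>H b) \<partial>lborel)"
    by (rule integral_distr) (use assms in auto)
  finally show ?thesis by simp
qed

section \<open>A continuously differentiable kernel and its derivative along horizontal
  segments\<close>

lemma has_real_derivative_max_square:
  "((\<lambda>x. (max 0 x)\<^sup>2) has_real_derivative 2 * max 0 x) (at x)"
proof -
  consider "x > 0" | "x < 0" | "x = 0" by linarith
  then show ?thesis
  proof cases
    case 1
    have "((\<lambda>x. x\<^sup>2) has_real_derivative 2 * max 0 x) (at x)"
      using 1 by (auto intro!: derivative_eq_intros)
    then show ?thesis
      by (rule has_field_derivative_transform_within_open[of _ _ _ "{0<..}"]) (use 1 in auto)
  next
    case 2
    have "((\<lambda>x. 0) has_real_derivative 2 * max 0 x) (at x)"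
      using 2 by (auto intro!: derivative_eq_intros)
    then show ?thesis
      by (rule has_field_derivative_transform_within_open[of _ _ _ "{..<0}"]) (use 2 in auto)
  next
    case 3
    have "((\<lambda>h. max 0 h) \<longlongrightarrow> 0) (at (0::real))"
      by (rule tendsto_eq_intros | simp)+
    moreover have "(max 0 h)\<^sup>2 / h = max 0 h" for h :: real
      by (auto simp: max_def power2_eq_square)
    ultimately show ?thesis
      using 3 by (simp add: has_field_derivative_iff)
  qed
qed

text \<open>A radial kernel vanishing outside the Euclidean ball of radius \<open>\<rho>\<close>.
  Squaring the positive part makes it continuously differentiable; it is not normalised, and its
  total mass is divided out at the end.\<close>

definition heis_bump :: "real \<Rightarrow> 'n::finite heis \<Rightarrow> real" where
  "heis_bump \<rho> a = (max 0 (\<rho>\<^sup>2 - a \<bullet> a))\<^sup>2"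

text \<open>The coefficient vector of the horizontal derivative in \<open>\<xi>\<close> of the kernel
  \<open>heis_bump \<rho> (a \<circ>\<^sub>H heis_inv \<xi>)\<close>.\<close>

definition bump_grad :: "real \<Rightarrow> 'n::finite heis \<Rightarrow> 'n heis \<Rightarrow> (real^'n) \<times> (real^'n)" where
  "bump_grad \<rho> a \<xi> = (let b = a \<circ>\<^sub>H heis_inv \<xi> in
     (4 * max 0 (\<rho>\<^sup>2 - b \<bullet> b)) *\<^sub>R
       (fst b + (2 * snd (snd b)) *\<^sub>R (fst (snd a) + fst (snd \<xi>)),
        fst (snd b) - (2 * snd (snd b)) *\<^sub>R (fst a + fst \<xi>)))"

text \<open>Along a horizontal segment the coordinates of the kernel's argument are affine in
  \<open>s\<close>, and horizontality expresses the slope of the last one through the slopes of the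
  other two. Hence the chain rule gives a derivative linear in
  \<open>Pr1 \<eta> - Pr1 \<xi>\<close>.\<close>

lemma bump_grad_vector_derivative:
  assumes "\<eta> \<in> horiz_plane \<xi>"
  shows "((\<lambda>s. heis_bump \<rho> (a \<circ>\<^sub>H heis_inv (\<xi> + s *\<^sub>R (\<eta> - \<xi>)))) has_vector_derivative
     bump_grad \<rho> a (\<xi> + s *\<^sub>R (\<eta> - \<xi>)) \<bullet> (Pr1 \<eta> - Pr1 \<xi>)) (at s within U)"
proof -
  obtain x y t where xi: "\<xi> = (x, y, t)" by (cases \<xi>)
  obtain x' y' t' where eta: "\<eta> = (x', y', t')" by (cases \<eta>)
  obtain a1 a2 a3 where a: "a = (a1, a2, a3)" by (cases a)
  have t': "t' = t + 2 * (x' \<bullet> y - x \<bullet> y')"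
    using assms by (simp add: xi eta horiz_plane_def)
  define p q where "p = x' - x" and "q = y' - y"
  define X Y T where "X s = a1 - x - s *\<^sub>R p" and "Y s = a2 - y - s *\<^sub>R q"
    and "T s = a3 - t + 2 * (a1 \<bullet> y - a2 \<bullet> x) + s * (2 * (a1 \<bullet> q - a2 \<bullet> p) - 2 * (p \<bullet> y - x \<bullet> q))" for s
  have b: "a \<circ>\<^sub>H heis_inv (\<xi> + s *\<^sub>R (\<eta> - \<xi>)) = (X s, Y s, T s)" for s
    by (simp add: xi eta a t' p_def q_def X_def Y_def T_def heis_mult_def heis_inv_def algebra_simps inner_commute)
  have N: "((\<lambda>s. \<rho>\<^sup>2 - (X s, Y s, T s) \<bullet> (X s, Y s, T s)) has_real_derivative
      2 * (X s \<bullet> p) + 2 * (Y s \<bullet> q) - 2 * T s * (2 * (a1 \<bullet> q - a2 \<bullet> p) - 2 * (p \<bullet> y - x \<bullet> q))) (at s within U)"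
  proof -
    have X: "((\<lambda>s. X s \<bullet> X s) has_real_derivative - 2 * (X s \<bullet> p)) (at s within U)"
      unfolding X_def inner_diff_left inner_diff_right inner_scaleR_left inner_scaleR_right
      by (auto intro!: derivative_eq_intros simp: algebra_simps inner_commute)
    have Y: "((\<lambda>s. Y s \<bullet> Y s) has_real_derivative - 2 * (Y s \<bullet> q)) (at s within U)"
      unfolding Y_def inner_diff_left inner_diff_right inner_scaleR_left inner_scaleR_right
      by (auto intro!: derivative_eq_intros simp: algebra_simps inner_commute)
    have T: "(T has_real_derivative (2 * (a1 \<bullet> q - a2 \<bullet> p) - 2 * (p \<bullet> y - x \<bullet> q))) (at s within U)"
      unfolding T_def by (auto intro!: derivative_eq_intros)
    show ?thesis
      unfolding inner_Pair inner_real_def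
      by (rule derivative_eq_intros X Y T refl)+ (simp add: algebra_simps)
  qed
  have "((\<lambda>s. heis_bump \<rho> (X s, Y s, T s)) has_real_derivative
      2 * max 0 (\<rho>\<^sup>2 - (X s, Y s, T s) \<bullet> (X s, Y s, T s)) *
      (2 * (X s \<bullet> p) + 2 * (Y s \<bullet> q) - 2 * T s * (2 * (a1 \<bullet> q - a2 \<bullet> p) - 2 * (p \<bullet> y - x \<bullet> q)))) (at s within U)"
    unfolding heis_bump_def by (rule DERIV_chain2[OF has_real_derivative_max_square N])
  \<comment> \<open>The coefficients are rewritten at the moving point of the segment; the terms
    added for this are multiples of \<open>s * (p \<bullet> q)\<close> with opposite signs and
    cancel.\<close>
  moreover have "2 * (X s \<bullet> p) + 2 * (Y s \<bullet> q) - 2 * T s * (2 * (a1 \<bullet> q - a2 \<bullet> p) - 2 * (p \<bullet> y - x \<bullet> q))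
      = 2 * ((X s + (2 * T s) *\<^sub>R (a2 + (y + s *\<^sub>R q))) \<bullet> p + (Y s - (2 * T s) *\<^sub>R (a1 + (x + s *\<^sub>R p))) \<bullet> q)"
    by (simp add: algebra_simps inner_commute)
  then have "2 * max 0 (\<rho>\<^sup>2 - (X s, Y s, T s) \<bullet> (X s, Y s, T s)) *
      (2 * (X s \<bullet> p) + 2 * (Y s \<bullet> q) - 2 * T s * (2 * (a1 \<bullet> q - a2 \<bullet> p) - 2 * (p \<bullet> y - x \<bullet> q)))
     = bump_grad \<rho> a (\<xi> + s *\<^sub>R (\<eta> - \<xi>)) \<bullet> (Pr1 \<eta> - Pr1 \<xi>)"
    unfolding bump_grad_def b Let_def
    by (simp add: xi eta a Pr1_def distrib_left flip: p_def q_def)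
  ultimately show ?thesis
    by (simp add: b has_real_derivative_iff_has_vector_derivative)
qed

lemma continuous_heis_bump [continuous_intros]:
  assumes "continuous_on S f"
  shows "continuous_on S (\<lambda>x. heis_bump \<rho> (f x))"
  unfolding heis_bump_def by (intro continuous_intros assms)

lemma continuous_bump_grad [continuous_intros]:
  assumes "continuous_on S f" "continuous_on S g"
  shows "continuous_on S (\<lambda>x. bump_grad \<rho> (f x) (g x))"
  unfolding bump_grad_def Let_def by (intro continuous_intros assms)

lemma heis_bump_nonneg: "0 \<le> heis_bump \<rho> a"
  by (simp add: heis_bump_def)

lemma heis_bump_eq_0:
  assumes "\<rho> > 0" "norm a > \<rho>"
  shows "heis_bump \<rho> a = 0"
proof -
  have "\<rho>\<^sup>2 \<le> a \<bullet> a"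
    using assms by (simp add: power2_norm_eq_inner[symmetric] power_mono)
  then show ?thesis by (simp add: heis_bump_def)
qed

lemma integrable_heis_bump:
  assumes "\<rho> > 0" "continuous_on UNIV h"
  shows "integrable lborel (\<lambda>a. heis_bump \<rho> a * h a)"
proof -
  have "integrable lborel (\<lambda>a. indicator (cball 0 \<rho>) a *\<^sub>R (heis_bump \<rho> a * h a))"
    by (intro borel_integrable_compact continuous_intros continuous_on_subset[OF assms(2)]) auto
  moreover have "indicator (cball 0 \<rho>) a *\<^sub>R (heis_bump \<rho> a * h a) = heis_bump \<rho> a * h a" for a
    using heis_bump_eq_0[OF assms(1), of a] by (auto simp: indicator_def)
  ultimately show ?thesis by (simp only:)
qed

text \<open>On the ball of half the radius the kernel is bounded below by a positive constant. The
  integral is the divisor that normalises the mollification.\<close>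

lemma integral_heis_bump_pos:
  assumes "\<rho> > 0"
  shows "0 < (\<integral>a. heis_bump \<rho> (a :: 'n::finite heis) \<partial>lborel)"
proof -
  let ?I = "\<lambda>a :: 'n heis. indicator (cball 0 (\<rho> / 2)) a * (\<rho>\<^sup>2 / 2)\<^sup>2"
  have "0 < measure lborel (cball (0 :: 'n heis) (\<rho> / 2)) * (\<rho>\<^sup>2 / 2)\<^sup>2"
    using assms by (intro mult_pos_pos) (auto simp: content_cball_pos)
  also have "\<dots> = (\<integral>a. ?I a \<partial>lborel)"
    by (simp add: emeasure_lborel_cball_finite)
  also have "\<dots> \<le> (\<integral>a. heis_bump \<rho> (a :: 'n heis) \<partial>lborel)"
  proof (rule integral_mono)
    show "integrable lborel ?I"
      by (intro integrable_mult_left integrable_real_indicator) (use emeasure_bounded_finite[OF bounded_cball] in \<open>auto simp: infinity_ennreal_def\<close>)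
    show "integrable lborel (heis_bump \<rho> :: 'n heis \<Rightarrow> real)"
      using integrable_heis_bump[OF assms, of "\<lambda>_. 1"] by simp
    fix a :: "'n heis"
    show "?I a \<le> heis_bump \<rho> a"
    proof (cases "a \<in> cball 0 (\<rho> / 2)")
      case True
      then have "(norm a)\<^sup>2 \<le> (\<rho> / 2)\<^sup>2" by (intro power_mono) auto
      then have "a \<bullet> a \<le> \<rho>\<^sup>2 / 4"
        by (simp add: power2_norm_eq_inner power_divide)
      then have "\<rho>\<^sup>2 / 2 \<le> max 0 (\<rho>\<^sup>2 - a \<bullet> a)"
        using inner_ge_zero[of a] by (simp only: le_max_iff_disj) linarith
      then have "(\<rho>\<^sup>2 / 2)\<^sup>2 \<le> (max 0 (\<rho>\<^sup>2 - a \<bullet> a))\<^sup>2"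
        by (intro power_mono) auto
      then show ?thesis using True by (simp add: heis_bump_def)
    qed (simp add: heis_bump_nonneg)
  qed
  finally show ?thesis .
qed

section \<open>The mollified function and its horizontal gradient\<close>

text \<open>Averaging \<open>g\<close> over left translations by small elements keeps it H-convex, and by the right
  invariance of Lebesgue measure the average is horizontally \<open>C\<^sup>1\<close>; the selection is its
  horizontal gradient.\<close>

lemma approximate_subgradient_selection:
  fixes \<Omega> :: "'n::finite heis set"
  assumes \<Omega>: "open \<Omega>" "bounded \<Omega>" "H_convex_set \<Omega>"
    and g: "continuous_on (closure \<Omega>) g" "H_convex_fun (closure \<Omega>) g"
    and K: "compact K" "K \<subseteq> \<Omega>" and e: "e > 0"
  obtains f where "continuous_on K f"
    "\<And>\<xi> \<eta>. \<xi> \<in> K \<Longrightarrow> \<eta> \<in> K \<Longrightarrow> \<eta> \<in> horiz_plane \<xi> \<Longrightarrow>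
       g \<xi> + f \<xi> \<bullet> (Pr1 \<eta> - Pr1 \<xi>) - e \<le> g \<eta>"
proof -
  have "compact (closure \<Omega>)" using \<Omega> by simp
  then have "bounded (g ` closure \<Omega>)"
    using compact_continuous_image[OF g(1)] compact_imp_bounded by blast
  then obtain B where B: "\<And>x. x \<in> closure \<Omega> \<Longrightarrow> norm (g x) \<le> B" "0 \<le> B"
    unfolding bounded_pos by (metis imageI less_imp_le)
  \<comment> \<open>The extension lets the mollification be integrated over the whole group; for
    base points in \<open>K\<close> the kernel will only see values inside \<Omega>.\<close>
  obtain G where G: "continuous_on UNIV G" "\<And>x. x \<in> closure \<Omega> \<Longrightarrow> G x = g x"
    by (rule Tietze[OF g(1) _ B(2) B(1)]) (auto simp del: split_paired_All)
  have Gg: "G x = g x" if "x \<in> \<Omega>" for x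
    using that closure_subset G(2) by blast
  note Gcont [continuous_intros] = continuous_on_compose2[OF G(1) _ subset_UNIV]
  obtain d where d: "d > 0" "(\<Union>x\<in>K. ball x d) \<subseteq> \<Omega>"
    using compact_subset_open_imp_ball_epsilon_subset[OF K(1) \<Omega>(1) K(2)] by blast
  let ?C = "cball (0::'n heis) 1 \<times> K"
  have C: "compact ?C" using K by (simp add: compact_Times)
  have "uniformly_continuous_on ?C (\<lambda>p. fst p \<circ>\<^sub>H snd p)"
    by (intro compact_uniformly_continuous C continuous_intros)
  then obtain r1 where r1: "r1 > 0" "\<And>p q. p \<in> ?C \<Longrightarrow> q \<in> ?C \<Longrightarrow> dist q p < r1
      \<Longrightarrow> dist (fst q \<circ>\<^sub>H snd q) (fst p \<circ>\<^sub>H snd p) < d"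
    using d(1) unfolding uniformly_continuous_on_def by blast
  have "uniformly_continuous_on ?C (\<lambda>p. G (fst p \<circ>\<^sub>H snd p))"
    by (intro compact_uniformly_continuous C continuous_intros)
  then obtain r2 where r2: "r2 > 0" "\<And>p q. p \<in> ?C \<Longrightarrow> q \<in> ?C \<Longrightarrow> dist q p < r2
      \<Longrightarrow> dist (G (fst q \<circ>\<^sub>H snd q)) (G (fst p \<circ>\<^sub>H snd p)) < e / 2"
    using e unfolding uniformly_continuous_on_def by (metis half_gt_zero)
  \<comment> \<open>Halving makes \<open>\<rho>\<close> strictly smaller than all three bounds: 1
    keeps \<open>a\<close> in the compact set of uniform continuity, \<open>r1\<close> keeps the
    translate within \<open>d\<close> of the base point and so in \<Omega>, and \<open>r2\<close>
    keeps the oscillation of \<open>G\<close> below \<open>e / 2\<close>.\<close>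
  define \<rho> where "\<rho> = min 1 (min r1 r2) / 2"
  have \<rho>: "\<rho> > 0" "\<rho> < 1" "\<rho> < r1" "\<rho> < r2"
    using r1 r2 by (auto simp: \<rho>_def)
  have near: "a \<circ>\<^sub>H \<xi> \<in> \<Omega>" "\<bar>G (a \<circ>\<^sub>H \<xi>) - g \<xi>\<bar> \<le> e / 2" if "norm a \<le> \<rho>" "\<xi> \<in> K" for a \<xi>
  proof -
    have p: "(0, \<xi>) \<in> ?C" "(a, \<xi>) \<in> ?C" using that \<rho> by auto
    have "dist (a, \<xi>) (0, \<xi>) < r1" "dist (a, \<xi>) (0, \<xi>) < r2"
      using that \<rho> by (auto simp: dist_Pair_Pair)
    from r1(2)[OF p this(1)] r2(2)[OF p this(2)]
    have "dist \<xi> (a \<circ>\<^sub>H \<xi>) < d" and *: "\<bar>G (a \<circ>\<^sub>H \<xi>) - G \<xi>\<bar> < e / 2"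
      by (auto simp: dist_commute dist_real_def abs_minus_commute)
    then have "a \<circ>\<^sub>H \<xi> \<in> ball \<xi> d" by simp
    then show "a \<circ>\<^sub>H \<xi> \<in> \<Omega>" using d(2) that(2) by blast
    show "\<bar>G (a \<circ>\<^sub>H \<xi>) - g \<xi>\<bar> \<le> e / 2" using * Gg[of \<xi>] that K by auto
  qed
  define c where "c = (\<integral>a. heis_bump \<rho> (a :: 'n heis) \<partial>lborel)"
  have c: "c > 0" unfolding c_def by (rule integral_heis_bump_pos[OF \<rho>(1)])
  define J where "J \<xi> = (\<integral>a. heis_bump \<rho> a * G (a \<circ>\<^sub>H \<xi>) \<partial>lborel)" for \<xi>
  have Jint: "integrable lborel (\<lambda>a. heis_bump \<rho> a * G (a \<circ>\<^sub>H \<xi>))" for \<xi>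
    by (intro integrable_heis_bump \<rho> continuous_intros)
  have cint: "integrable lborel (heis_bump \<rho> :: 'n heis \<Rightarrow> real)"
    using integrable_heis_bump[OF \<rho>(1), of "\<lambda>_. 1"] by simp
  \<comment> \<open>The error \<open>e / 2\<close> is paid once at each end of a segment, giving
    \<open>e\<close> in total after division by \<open>c\<close>.\<close>
  have Jg: "\<bar>J \<xi> - c * g \<xi>\<bar> \<le> c * (e / 2)" if "\<xi> \<in> K" for \<xi>
  proof -
    have pt: "\<bar>heis_bump \<rho> a * (G (a \<circ>\<^sub>H \<xi>) - g \<xi>)\<bar> \<le> heis_bump \<rho> a * (e / 2)" for a
    proof (cases "norm a \<le> \<rho>")
      case True
      show ?thesis
        using mult_left_mono[OF near(2)[OF True that] heis_bump_nonneg[of \<rho> a]]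
        by (simp add: abs_mult heis_bump_nonneg)
    qed (simp add: heis_bump_eq_0[OF \<rho>(1)])
    have "J \<xi> - c * g \<xi> = (\<integral>a. heis_bump \<rho> a * (G (a \<circ>\<^sub>H \<xi>) - g \<xi>) \<partial>lborel)"
      unfolding J_def c_def using Jint cint by (simp add: right_diff_distrib)
    also have "\<bar>\<dots>\<bar> \<le> (\<integral>a. \<bar>heis_bump \<rho> a * (G (a \<circ>\<^sub>H \<xi>) - g \<xi>)\<bar> \<partial>lborel)"
      by (rule integral_abs_bound)
    also have "\<dots> \<le> (\<integral>a. heis_bump \<rho> (a :: 'n heis) * (e / 2) \<partial>lborel)"
    proof (rule integral_mono)
      show "integrable lborel (\<lambda>a. \<bar>heis_bump \<rho> a * (G (a \<circ>\<^sub>H \<xi>) - g \<xi>)\<bar>)"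
        by (intro integrable_abs integrable_heis_bump \<rho> continuous_intros)
    qed (use cint pt in auto)
    also have "\<dots> = c * (e / 2)" by (simp add: c_def)
    finally show ?thesis .
  qed
  \<comment> \<open>For every \<open>a\<close> in the support of the kernel, the translated segment
    is horizontal with end points in \<Omega>, so \<open>g\<close> is convex along it; the
    inequality is then integrated over \<open>a\<close>.\<close>
  have Jconv: "J (\<xi> + s *\<^sub>R (\<eta> - \<xi>)) \<le> J \<xi> + s * (J \<eta> - J \<xi>)"
    if "\<xi> \<in> K" "\<eta> \<in> K" and h: "\<eta> \<in> horiz_plane \<xi>" and s: "0 \<le> s" "s \<le> 1" for \<xi> \<eta> s
  proof -
    have pt: "heis_bump \<rho> a * G (a \<circ>\<^sub>H (\<xi> + s *\<^sub>R (\<eta> - \<xi>))) \<le>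
        heis_bump \<rho> a * G (a \<circ>\<^sub>H \<xi>) + s * (heis_bump \<rho> a * G (a \<circ>\<^sub>H \<eta>) - heis_bump \<rho> a * G (a \<circ>\<^sub>H \<xi>))" for a
    proof (cases "norm a \<le> \<rho>")
      case True
      let ?\<xi> = "a \<circ>\<^sub>H \<xi>" and ?\<eta> = "a \<circ>\<^sub>H \<eta>"
      have in\<Omega>: "?\<xi> \<in> \<Omega>" "?\<eta> \<in> \<Omega>" using near that True by auto
      have hh: "?\<eta> \<in> horiz_plane ?\<xi>" by (rule heis_mult_horiz_plane[OF h])
      have "?\<xi> + s *\<^sub>R (?\<eta> - ?\<xi>) \<in> \<Omega>"
        using \<Omega>(3) in\<Omega> hh s horizontal_segment[of ?\<xi> ?\<eta> s]
        unfolding H_convex_set_def by (metis horiz_plane_sym)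
      then have "G (a \<circ>\<^sub>H (\<xi> + s *\<^sub>R (\<eta> - \<xi>))) = g (?\<xi> + s *\<^sub>R (?\<eta> - ?\<xi>))"
        by (simp add: heis_mult_segment Gg)
      also have "\<dots> \<le> g ?\<xi> + s * (g ?\<eta> - g ?\<xi>)"
        by (rule H_convex_fun_segment[OF \<Omega>(3) g(2) in\<Omega> hh s])
      finally have "heis_bump \<rho> a * G (a \<circ>\<^sub>H (\<xi> + s *\<^sub>R (\<eta> - \<xi>))) \<le>
          heis_bump \<rho> a * (G ?\<xi> + s * (G ?\<eta> - G ?\<xi>))"
        using in\<Omega> by (intro mult_left_mono heis_bump_nonneg) (simp add: Gg)
      then show ?thesis by (simp add: algebra_simps)
    qed (simp add: heis_bump_eq_0[OF \<rho>(1)])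
    have "J (\<xi> + s *\<^sub>R (\<eta> - \<xi>)) \<le> (\<integral>a. heis_bump \<rho> a * G (a \<circ>\<^sub>H \<xi>) +
        s * (heis_bump \<rho> a * G (a \<circ>\<^sub>H \<eta>) - heis_bump \<rho> a * G (a \<circ>\<^sub>H \<xi>)) \<partial>lborel)"
      unfolding J_def using Jint pt by (intro integral_mono) auto
    also have "\<dots> = J \<xi> + s * (J \<eta> - J \<xi>)"
      unfolding J_def using Jint by simp
    finally show ?thesis .
  qed
  \<comment> \<open>Segments between points of \<open>K\<close> may leave \<open>K\<close>; the
    convex hull is a compact set containing all of them. It may also leave \<Omega>, which is
    harmless because \<open>G\<close> is defined everywhere.\<close>
  define Z where "Z = convex hull K"
  have Z: "compact Z" "K \<subseteq> Z" "convex Z"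
    using K hull_subset[of K convex] by (simp_all add: Z_def compact_convex_hull)
  have "compact ((\<lambda>p. fst p \<circ>\<^sub>H snd p) ` (cball 0 \<rho> \<times> Z))"
    using Z by (intro compact_continuous_image compact_Times continuous_intros) auto
  then obtain l u where lu: "(\<lambda>p. fst p \<circ>\<^sub>H snd p) ` (cball 0 \<rho> \<times> Z) \<subseteq> cbox l u"
    using compact_imp_bounded bounded_subset_cbox_symmetric by meson
  \<comment> \<open>Right invariance moves the dependence on the base point from \<open>G\<close>,
    which is merely continuous, to the kernel, so that one can differentiate under the integral. The
    box is the same for all base points in \<open>Z\<close>.\<close>
  have JHK: "J \<zeta> = integral (cbox l u) (\<lambda>a. heis_bump \<rho> (a \<circ>\<^sub>H heis_inv \<zeta>) * G a)" if "\<zeta> \<in> Z" for \<zeta>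
  proof -
    let ?h = "\<lambda>a. heis_bump \<rho> (a \<circ>\<^sub>H heis_inv \<zeta>) * G a"
    have h: "continuous_on UNIV ?h" by (intro continuous_intros)
    have out: "?h a = 0" if "a \<notin> cbox l u" for a
    proof -
      have "norm (a \<circ>\<^sub>H heis_inv \<zeta>) > \<rho>"
      proof (rule ccontr)
        assume "\<not> ?thesis"
        then have "(a \<circ>\<^sub>H heis_inv \<zeta>, \<zeta>) \<in> cball 0 \<rho> \<times> Z" using \<open>\<zeta> \<in> Z\<close> by auto
        then have "(a \<circ>\<^sub>H heis_inv \<zeta>) \<circ>\<^sub>H \<zeta> \<in> cbox l u" using lu by fastforce
        then show False using that by simp
      qed
      then show ?thesis by (simp add: heis_bump_eq_0[OF \<rho>(1)])
    qed
    have "integrable lborel (\<lambda>a. indicator (cbox l u) a *\<^sub>R ?h a)"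
      by (rule borel_integrable_compact) (auto intro: continuous_on_subset[OF h])
    moreover have ind: "indicator (cbox l u) a *\<^sub>R ?h a = ?h a" for a
      using out[of a] by (auto simp: indicator_def)
    ultimately have hi: "integrable lborel ?h" by (simp only:)
    have "J \<zeta> = (\<integral>a. ?h (a \<circ>\<^sub>H \<zeta>) \<partial>lborel)"
      by (simp add: J_def)
    also have "\<dots> = (\<integral>a. ?h a \<partial>lborel)"
      by (rule integral_heis_mult_right) (use h in \<open>simp add: borel_measurable_continuous_onI\<close>)
    also have "\<dots> = integral UNIV ?h"
      by (rule integral_lborel[OF hi, symmetric])
    also have "\<dots> = integral UNIV (\<lambda>a. if a \<in> cbox l u then ?h a else 0)"
      by (rule arg_cong[where f = "integral UNIV"]) (use out in auto)
    also have "\<dots> = integral (cbox l u) ?h"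
      by (rule integral_restrict_UNIV)
    finally show ?thesis .
  qed
  define F where "F \<xi> = integral (cbox l u) (\<lambda>a. G a *\<^sub>R bump_grad \<rho> a \<xi>)" for \<xi>
  have Fcont: "continuous_on UNIV F"
    unfolding F_def
    by (rule integral_continuous_on_param) (unfold case_prod_unfold, intro continuous_intros)
  \<comment> \<open>By convexity, the one-sided derivative of \<open>J\<close> at the start of the
    segment is at most the increment of \<open>J\<close> over the whole segment.\<close>
  have FJ: "F \<xi> \<bullet> (Pr1 \<eta> - Pr1 \<xi>) \<le> J \<eta> - J \<xi>"
    if "\<xi> \<in> K" "\<eta> \<in> K" and h: "\<eta> \<in> horiz_plane \<xi>" for \<xi> \<eta>
  proof -
    let ?w = "Pr1 \<eta> - Pr1 \<xi>"
    have inZ: "\<xi> + s *\<^sub>R (\<eta> - \<xi>) \<in> Z" if "s \<in> {0..1}" for s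
    proof -
      have "(1 - s) *\<^sub>R \<xi> + s *\<^sub>R \<eta> \<in> Z"
        using Z \<open>\<xi> \<in> K\<close> \<open>\<eta> \<in> K\<close> that by (intro convexD_alt) auto
      then show ?thesis by (simp add: algebra_simps)
    qed
    have deriv: "((\<lambda>s. integral (cbox l u) (\<lambda>a. heis_bump \<rho> (a \<circ>\<^sub>H heis_inv (\<xi> + s *\<^sub>R (\<eta> - \<xi>))) * G a))
        has_vector_derivative integral (cbox l u) (\<lambda>a. bump_grad \<rho> a (\<xi> + 0 *\<^sub>R (\<eta> - \<xi>)) \<bullet> ?w * G a))
        (at 0 within {0..1})"
    proof (rule leibniz_rule_vector_derivative)
      fix s :: real and a
      show "((\<lambda>s. heis_bump \<rho> (a \<circ>\<^sub>H heis_inv (\<xi> + s *\<^sub>R (\<eta> - \<xi>))) * G a) has_vector_derivative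
          bump_grad \<rho> a (\<xi> + s *\<^sub>R (\<eta> - \<xi>)) \<bullet> ?w * G a) (at s within {0..1})"
        by (rule has_vector_derivative_mult_left[OF bump_grad_vector_derivative[OF h]])
    next
      fix s :: real
      show "(\<lambda>a. heis_bump \<rho> (a \<circ>\<^sub>H heis_inv (\<xi> + s *\<^sub>R (\<eta> - \<xi>))) * G a) integrable_on cbox l u"
        by (intro integrable_continuous continuous_intros)
    next
      show "continuous_on ({0..1} \<times> cbox l u)
          (\<lambda>(s, a). bump_grad \<rho> a (\<xi> + s *\<^sub>R (\<eta> - \<xi>)) \<bullet> ?w * G a)"
        unfolding case_prod_unfold by (intro continuous_intros)
    qed auto
    have Feq: "integral (cbox l u) (\<lambda>a. bump_grad \<rho> a (\<xi> + 0 *\<^sub>R (\<eta> - \<xi>)) \<bullet> ?w * G a) = F \<xi> \<bullet> ?w"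
    proof -
      have "(\<lambda>a. G a *\<^sub>R bump_grad \<rho> a \<xi>) integrable_on cbox l u"
        by (intro integrable_continuous continuous_intros)
      from integral_linear[OF this bounded_linear_inner_left[of ?w]]
      show ?thesis by (simp add: F_def o_def mult.commute)
    qed
    have "((\<lambda>s. J (\<xi> + s *\<^sub>R (\<eta> - \<xi>))) has_vector_derivative F \<xi> \<bullet> ?w) (at 0 within {0..1})"
      by (rule has_vector_derivative_transform[OF _ _ deriv[unfolded Feq]])
         (use inZ JHK in \<open>simp_all only: atLeastAtMost_iff zero_le_one order_refl\<close>)
    then have lim: "((\<lambda>s. (J (\<xi> + s *\<^sub>R (\<eta> - \<xi>)) - J \<xi>) / s) \<longlongrightarrow> F \<xi> \<bullet> ?w) (at 0 within {0..1})"
      by (simp add: has_real_derivative_iff_has_vector_derivative[symmetric] has_field_derivative_iff)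
    show ?thesis
    proof (rule tendsto_upperbound[OF lim])
      show "eventually (\<lambda>s. (J (\<xi> + s *\<^sub>R (\<eta> - \<xi>)) - J \<xi>) / s \<le> J \<eta> - J \<xi>) (at 0 within {0..1})"
        unfolding eventually_at_filter
      proof (intro always_eventually allI impI)
        fix s :: real assume "s \<noteq> 0" "s \<in> {0..1}"
        then show "(J (\<xi> + s *\<^sub>R (\<eta> - \<xi>)) - J \<xi>) / s \<le> J \<eta> - J \<xi>"
          using Jconv[OF that, of s] by (simp add: divide_le_eq mult.commute)
      qed
      show "at (0::real) within {0..1} \<noteq> bot"
        by (simp add: trivial_limit_within islimpt_Icc)
    qed
  qed
  show ?thesis
  proof
    show "continuous_on K (\<lambda>\<xi>. F \<xi> /\<^sub>R c)"
      by (intro continuous_intros continuous_on_subset[OF Fcont]) auto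
    fix \<xi> \<eta> assume *: "\<xi> \<in> K" "\<eta> \<in> K" "\<eta> \<in> horiz_plane \<xi>"
    have "F \<xi> \<bullet> (Pr1 \<eta> - Pr1 \<xi>) \<le> (c * g \<eta> - c * g \<xi>) + (c * (e / 2) + c * (e / 2))"
      using FJ[OF *] Jg[OF *(1)] Jg[OF *(2)] by linarith
    then have "F \<xi> \<bullet> (Pr1 \<eta> - Pr1 \<xi>) \<le> c * (g \<eta> - g \<xi> + e)"
      by (simp add: algebra_simps)
    then have "(F \<xi> \<bullet> (Pr1 \<eta> - Pr1 \<xi>)) / c \<le> g \<eta> - g \<xi> + e"
      using c by (simp add: divide_le_eq mult.commute)
    then show "g \<xi> + (F \<xi> /\<^sub>R c) \<bullet> (Pr1 \<eta> - Pr1 \<xi>) - e \<le> g \<eta>"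
      by (simp add: divide_inverse mult.commute)
  qed
qed

section \<open>Horizontal subgradients\<close>

lemma tendsto_hlift [tendsto_intros]:
  assumes "(f \<longlongrightarrow> a) F" "(g \<longlongrightarrow> b) F"
  shows "((\<lambda>x. hlift (f x) (g x)) \<longlongrightarrow> hlift a b) F"
  unfolding hlift_def by (intro tendsto_intros assms)

lemma tendsto_Pr1 [tendsto_intros]:
  assumes "(f \<longlongrightarrow> a) F"
  shows "((\<lambda>x. Pr1 (f x)) \<longlongrightarrow> Pr1 a) F"
  unfolding Pr1_eq by (intro tendsto_intros assms)

lemma closed_horiz_plane: "closed (horiz_plane \<xi>)"
proof -
  have "horiz_plane \<xi> = {\<eta>. hlift \<xi> (Pr1 \<eta>) = \<eta>}" by (auto simp: horiz_plane_iff)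
  then show ?thesis by (simp only:) (intro closed_Collect_eq continuous_intros)
qed

lemma norm_Pr1_le: "norm (Pr1 \<xi>) \<le> norm \<xi>"
  by (cases \<xi>) (auto simp: Pr1_def norm_Pair intro!: real_sqrt_le_mono)

text \<open>The planes move with the base points, so a test point in the limit plane is replaced by
  the points above the same projection in the approximating planes. These converge to it and
  eventually stay in a compact ball inside \<Omega>, which is why inequalities on compact sets
  suffice.\<close>

lemma H_subdiff_limit:
  fixes \<xi>s :: "nat \<Rightarrow> 'n::finite heis"
  assumes \<Omega>: "open \<Omega>" and g: "continuous_on \<Omega> g"
    and lim: "\<xi>s \<longlonglongrightarrow> \<xi>" "\<xi> \<in> \<Omega>" "ps \<longlonglongrightarrow> p" "es \<longlonglongrightarrow> 0"
    and ev: "\<And>K. compact K \<Longrightarrow> K \<subseteq> \<Omega> \<Longrightarrow> \<forall>\<^sub>F k in sequentially.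
      \<forall>\<eta>\<in>K \<inter> horiz_plane (\<xi>s k). g (\<xi>s k) + ps k \<bullet> (Pr1 \<eta> - Pr1 (\<xi>s k)) - es k \<le> g \<eta>"
  shows "p \<in> H_subdiff \<Omega> g \<xi>"
  unfolding H_subdiff_def
proof (intro CollectI ballI)
  fix \<eta> assume \<eta>: "\<eta> \<in> \<Omega> \<inter> horiz_plane \<xi>"
  have gt: "(\<lambda>k. g (\<zeta> k)) \<longlonglongrightarrow> g z" if "\<zeta> \<longlonglongrightarrow> z" "z \<in> \<Omega>" for \<zeta> z
  proof -
    have "isCont g z" using continuous_on_eq_continuous_at[OF \<Omega>] g that(2) by blast
    then show ?thesis by (rule isCont_tendsto_compose[OF _ that(1)])
  qed
  define \<eta>s where "\<eta>s k = hlift (\<xi>s k) (Pr1 \<eta>)" for k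
  have "\<eta>s \<longlonglongrightarrow> hlift \<xi> (Pr1 \<eta>)"
    unfolding \<eta>s_def by (intro tendsto_intros lim)
  then have \<eta>s: "\<eta>s \<longlonglongrightarrow> \<eta>" using \<eta> by (simp add: horiz_plane_iff)
  obtain r where r: "r > 0" "cball \<eta> r \<subseteq> \<Omega>"
    using \<eta> \<Omega> open_contains_cball by blast
  have "\<forall>\<^sub>F k in sequentially. \<eta>s k \<in> cball \<eta> r"
    using tendstoD[OF \<eta>s r(1)] by eventually_elim (simp add: dist_commute)
  moreover have "\<forall>\<^sub>F k in sequentially. \<forall>\<eta>'\<in>cball \<eta> r \<inter> horiz_plane (\<xi>s k).
      g (\<xi>s k) + ps k \<bullet> (Pr1 \<eta>' - Pr1 (\<xi>s k)) - es k \<le> g \<eta>'"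
    by (rule ev) (use r in auto)
  ultimately have le: "\<forall>\<^sub>F k in sequentially.
      g (\<xi>s k) + ps k \<bullet> (Pr1 (\<eta>s k) - Pr1 (\<xi>s k)) - es k \<le> g (\<eta>s k)"
  proof eventually_elim
    case (elim k)
    then show ?case using elim(2)[rule_format, of "\<eta>s k"] by (simp add: \<eta>s_def)
  qed
  have "(\<lambda>k. g (\<xi>s k) + ps k \<bullet> (Pr1 (\<eta>s k) - Pr1 (\<xi>s k)) - es k) \<longlonglongrightarrow>
      g \<xi> + p \<bullet> (Pr1 \<eta> - Pr1 \<xi>) - 0"
    by (intro tendsto_intros lim \<eta>s gt)
  moreover have "(\<lambda>k. g (\<eta>s k)) \<longlonglongrightarrow> g \<eta>"
    by (rule gt[OF \<eta>s]) (use \<eta> in auto)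
  ultimately show "g \<xi> + p \<bullet> (Pr1 \<eta> - Pr1 \<xi>) \<le> g \<eta>"
    using tendsto_le[OF sequentially_bot _ _ le] by fastforce
qed

text \<open>Testing the inequality at horizontal distance \<open>\<rho>\<close> in the direction of
  \<open>p\<close> bounds \<open>\<rho> * norm p\<close> by the oscillation of \<open>g\<close> plus
  the error. A compact \<open>K'\<close> of test points is singled out because approximate
  subgradients are controlled only on compact sets.\<close>

lemma approximate_subgradients_bound:
  fixes \<Omega> :: "'n::finite heis set"
  assumes \<Omega>: "open \<Omega>" "bounded \<Omega>" and g: "continuous_on (closure \<Omega>) g"
    and K: "compact K" "K \<subseteq> \<Omega>"
  obtains R K' where "compact K'" "K' \<subseteq> \<Omega>"
    "\<And>\<xi> p e. \<xi> \<in> K \<Longrightarrow> e \<le> 1 \<Longrightarrow>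
       (\<forall>\<eta>\<in>K' \<inter> horiz_plane \<xi>. g \<xi> + p \<bullet> (Pr1 \<eta> - Pr1 \<xi>) - e \<le> g \<eta>) \<Longrightarrow> norm p \<le> R"
proof -
  have "bounded (g ` closure \<Omega>)"
    using compact_continuous_image[OF g] \<Omega> by (simp add: compact_imp_bounded)
  then obtain B where B: "\<And>x. x \<in> closure \<Omega> \<Longrightarrow> norm (g x) \<le> B"
    unfolding bounded_iff by (metis imageI)
  obtain d where d: "d > 0" "(\<Union>x\<in>K. ball x d) \<subseteq> \<Omega>"
    using compact_subset_open_imp_ball_epsilon_subset[OF K(1) \<Omega>(1) K(2)] by blast
  let ?h = "\<lambda>q. hlift (fst q) (Pr1 (fst q) + snd q)"
  let ?C = "K \<times> cball (0 :: (real^'n) \<times> (real^'n)) 1"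
  have "uniformly_continuous_on ?C ?h"
    by (intro compact_uniformly_continuous compact_Times compact_cball K continuous_intros)
  then obtain r where r: "r > 0" "\<And>p q. p \<in> ?C \<Longrightarrow> q \<in> ?C \<Longrightarrow> dist q p < r \<Longrightarrow> dist (?h q) (?h p) < d"
    using d(1) unfolding uniformly_continuous_on_def by blast
  define \<rho> where "\<rho> = min 1 r / 2"
  have \<rho>: "\<rho> > 0" "\<rho> < 1" "\<rho> < r" using r by (auto simp: \<rho>_def)
  define K' where "K' = ?h ` (K \<times> cball 0 \<rho>)"
  have "compact K'"
    unfolding K'_def by (intro compact_continuous_image compact_Times compact_cball K continuous_intros)
  moreover have K'\<Omega>: "K' \<subseteq> \<Omega>"
  proof
    fix \<eta> assume "\<eta> \<in> K'"
    then obtain \<xi> w where w: "\<xi> \<in> K" "norm w \<le> \<rho>" "\<eta> = ?h (\<xi>, w)" by (auto simp: K'_def)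
    have "dist (?h (\<xi>, w)) (?h (\<xi>, 0)) < d"
      by (rule r(2)) (use w \<rho> in \<open>auto simp: dist_Pair_Pair\<close>)
    then have "\<eta> \<in> ball \<xi> d" using w by (simp add: dist_commute)
    then show "\<eta> \<in> \<Omega>" using d w by blast
  qed
  moreover have bound: "norm p \<le> (2 * B + 1) / \<rho>"
    if "\<xi> \<in> K" "e \<le> 1" and le: "\<forall>\<eta>\<in>K' \<inter> horiz_plane \<xi>. g \<xi> + p \<bullet> (Pr1 \<eta> - Pr1 \<xi>) - e \<le> g \<eta>" for \<xi> p e
  proof -
    \<comment> \<open>For \<open>p = 0\<close> this is the zero vector, and the inequality used
      below remains valid.\<close>
    define w where "w = \<rho> *\<^sub>R sgn p"
    define \<eta> where "\<eta> = hlift \<xi> (Pr1 \<xi> + w)"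
    have "norm w \<le> \<rho>" using \<rho> by (simp add: w_def norm_sgn)
    then have \<eta>K: "\<eta> \<in> K'" using \<open>\<xi> \<in> K\<close> by (force simp: K'_def \<eta>_def)
    then have "g \<xi> + p \<bullet> w - e \<le> g \<eta>" using le[rule_format, of \<eta>] by (simp add: \<eta>_def)
    moreover have "\<xi> \<in> closure \<Omega>" "\<eta> \<in> closure \<Omega>"
      using \<eta>K K'\<Omega> \<open>\<xi> \<in> K\<close> K(2) closure_subset by blast+
    then have "\<bar>g \<xi>\<bar> \<le> B" "\<bar>g \<eta>\<bar> \<le> B" using B[of \<xi>] B[of \<eta>] by simp_all
    moreover have "p \<bullet> w = \<rho> * norm p"
      by (cases "p = 0")
         (simp_all add: w_def sgn_div_norm power2_norm_eq_inner[symmetric] power2_eq_square)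
    ultimately have "\<rho> * norm p \<le> 2 * B + 1" using \<open>e \<le> 1\<close> by linarith
    then show ?thesis using \<rho> by (simp add: le_divide_eq mult.commute)
  qed
  ultimately show ?thesis using that[of K' "(2 * B + 1) / \<rho>"] by blast
qed

text \<open>The mollified selections are taken along a compact exhaustion of \<Omega> with errors
  tending to 0, so that limits of their values become exact subgradients on all of \<Omega>.\<close>

lemma subgradient_approximations:
  fixes \<Omega> :: "'n::finite heis set"
  assumes \<Omega>: "open \<Omega>" "bounded \<Omega>" "H_convex_set \<Omega>"
    and g: "continuous_on (closure \<Omega>) g" "H_convex_fun (closure \<Omega>) g"
  obtains C f where "\<And>K. compact K \<Longrightarrow> K \<subseteq> \<Omega> \<Longrightarrow> \<forall>\<^sub>F n in sequentially. K \<subseteq> C n"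
    "\<And>n::nat. continuous_on (C n) (f n)"
    "\<And>n \<xi> \<eta>. \<xi> \<in> C n \<Longrightarrow> \<eta> \<in> C n \<Longrightarrow> \<eta> \<in> horiz_plane \<xi> \<Longrightarrow>
       g \<xi> + f n \<xi> \<bullet> (Pr1 \<eta> - Pr1 \<xi>) - inverse (Suc n) \<le> g \<eta>"
proof -
  obtain C where C: "\<And>n. compact (C n)" "\<And>n. C n \<subseteq> \<Omega>"
      "\<And>n. C n \<subseteq> interior (C (Suc n))" "\<Union>(range C) = \<Omega>"
      "\<And>K. \<lbrakk>compact K; K \<subseteq> \<Omega>\<rbrakk> \<Longrightarrow> \<exists>N. \<forall>n\<ge>N. K \<subseteq> C n"
    by (rule open_Union_compact_subsets[OF \<Omega>(1)]) blast
  have "\<exists>f. continuous_on (C n) f \<and> (\<forall>\<xi>\<in>C n. \<forall>\<eta>\<in>C n. \<eta> \<in> horiz_plane \<xi> \<longrightarrow>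
       g \<xi> + f \<xi> \<bullet> (Pr1 \<eta> - Pr1 \<xi>) - inverse (Suc n) \<le> g \<eta>)" for n
    by (rule approximate_subgradient_selection[OF \<Omega> g C(1)[of n] C(2)[of n], of "inverse (Suc n)"]) auto
  then have "\<forall>n. \<exists>f. continuous_on (C n) f \<and> (\<forall>\<xi>\<in>C n. \<forall>\<eta>\<in>C n. \<eta> \<in> horiz_plane \<xi> \<longrightarrow>
       g \<xi> + f \<xi> \<bullet> (Pr1 \<eta> - Pr1 \<xi>) - inverse (Suc n) \<le> g \<eta>)" ..
  from choice[OF this] obtain f where "\<And>n. continuous_on (C n) (f n)" "\<And>n. \<forall>\<xi>\<in>C n. \<forall>\<eta>\<in>C n. \<eta> \<in> horiz_plane \<xi> \<longrightarrow>
       g \<xi> + f n \<xi> \<bullet> (Pr1 \<eta> - Pr1 \<xi>) - inverse (Suc n) \<le> g \<eta>"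
    by blast
  with C(5) show ?thesis
    by (intro that[of C f]) (auto simp: eventually_sequentially)
qed

text \<open>The approximate selections at the point are bounded, and any limit of a subsequence is
  an exact subgradient.\<close>

lemma H_subdiff_nonempty:
  fixes \<Omega> :: "'n::finite heis set"
  assumes \<Omega>: "open \<Omega>" "bounded \<Omega>" "H_convex_set \<Omega>"
    and g: "continuous_on (closure \<Omega>) g" "H_convex_fun (closure \<Omega>) g"
    and \<xi>: "\<xi> \<in> \<Omega>"
  shows "H_subdiff \<Omega> g \<xi> \<noteq> {}"
proof -
  obtain C f where C: "\<And>K. compact K \<Longrightarrow> K \<subseteq> \<Omega> \<Longrightarrow> \<forall>\<^sub>F n in sequentially. K \<subseteq> C n"
    and "\<And>n. continuous_on (C n) (f n)"
    and f: "\<And>n \<xi> \<eta>. \<xi> \<in> C n \<Longrightarrow> \<eta> \<in> C n \<Longrightarrow> \<eta> \<in> horiz_plane \<xi> \<Longrightarrow>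
       g \<xi> + f n \<xi> \<bullet> (Pr1 \<eta> - Pr1 \<xi>) - inverse (Suc n) \<le> g \<eta>"
    by (rule subgradient_approximations[OF \<Omega> g]) blast
  have sing: "compact {\<xi>}" "{\<xi>} \<subseteq> \<Omega>" using \<xi> by auto
  obtain R K' where K': "compact K'" "K' \<subseteq> \<Omega>"
    and R: "\<And>\<zeta> p e. \<zeta> \<in> {\<xi>} \<Longrightarrow> e \<le> 1 \<Longrightarrow>
       (\<forall>\<eta>\<in>K' \<inter> horiz_plane \<zeta>. g \<zeta> + p \<bullet> (Pr1 \<eta> - Pr1 \<zeta>) - e \<le> g \<eta>) \<Longrightarrow> norm p \<le> R"
    by (rule approximate_subgradients_bound[OF \<Omega>(1,2) g(1) sing]) blast
  have in_C: "\<forall>\<^sub>F n in sequentially. \<xi> \<in> C n"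
    using C[of "{\<xi>}"] \<xi> by auto
  have "\<forall>\<^sub>F n in sequentially. norm (f n \<xi>) \<le> R"
    using C[OF K'] in_C
  proof eventually_elim
    case (elim n)
    have "inverse (real (Suc n)) \<le> 1" by (simp add: inverse_le_1_iff)
    moreover have "\<forall>\<eta>\<in>K' \<inter> horiz_plane \<xi>. g \<xi> + f n \<xi> \<bullet> (Pr1 \<eta> - Pr1 \<xi>) - inverse (Suc n) \<le> g \<eta>"
      using elim f by blast
    ultimately show ?case by (rule R[OF singletonI])
  qed
  \<comment> \<open>Only the tail from \<open>N\<close> on is bounded, so the sequence is shifted by
    \<open>N\<close>; this is the source of the indices \<open>r k + N\<close>.\<close>
  then obtain N where N: "\<And>n. n \<ge> N \<Longrightarrow> f n \<xi> \<in> cball 0 R"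
    by (auto simp: eventually_sequentially)
  obtain p r where r: "strict_mono r" "((\<lambda>n. f (n + N) \<xi>) \<circ> r) \<longlonglongrightarrow> p"
    using seq_compactE[OF compact_imp_seq_compact[OF compact_cball[of 0 R]], of "\<lambda>n. f (n + N) \<xi>"]
      N[OF le_add2] by blast
  have filt: "filterlim (\<lambda>k. r k + N) sequentially sequentially"
    by (rule filterlim_compose[OF filterlim_add_const_nat_at_top filterlim_subseq[OF r(1)]])
  have "p \<in> H_subdiff \<Omega> g \<xi>"
  proof (rule H_subdiff_limit[OF \<Omega>(1), where \<xi>s = "\<lambda>_. \<xi>" and es = "\<lambda>k. inverse (Suc (r k + N))"])
    show "continuous_on \<Omega> g" using g(1) closure_subset continuous_on_subset by blast
    show "((\<lambda>n. f (n + N) \<xi>) \<circ> r) \<longlonglongrightarrow> p" by fact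
    show "(\<lambda>k. inverse (real (Suc (r k + N)))) \<longlonglongrightarrow> 0"
      by (rule filterlim_compose[OF LIMSEQ_inverse_real_of_nat filt])
    fix K :: "'n heis set" assume K: "compact K" "K \<subseteq> \<Omega>"
    have "\<forall>\<^sub>F n in sequentially. \<forall>\<eta>\<in>K \<inter> horiz_plane \<xi>.
        g \<xi> + f n \<xi> \<bullet> (Pr1 \<eta> - Pr1 \<xi>) - inverse (Suc n) \<le> g \<eta>"
      using C[OF K] in_C by eventually_elim (use f in blast)
    from eventually_compose_filterlim[OF this filt]
    show "\<forall>\<^sub>F k in sequentially. \<forall>\<eta>\<in>K \<inter> horiz_plane \<xi>.
        g \<xi> + ((\<lambda>n. f (n + N) \<xi>) \<circ> r) k \<bullet> (Pr1 \<eta> - Pr1 \<xi>) - inverse (Suc (r k + N)) \<le> g \<eta>"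
      by simp
  qed (use \<xi> in auto)
  then show ?thesis by auto
qed

text \<open>Boundedness is the previous estimate with error 0. For closedness, base points of a
  convergent sequence of subgradients are passed to a convergent subsequence in
  \<open>K\<close>.\<close>

lemma compact_H_subdiff_set:
  fixes \<Omega> :: "'n::finite heis set"
  assumes \<Omega>: "open \<Omega>" "bounded \<Omega>" and g: "continuous_on (closure \<Omega>) g"
    and K: "compact K" "K \<subseteq> \<Omega>"
  shows "compact (H_subdiff_set \<Omega> g K)"
proof -
  obtain R K' where K': "compact K'" "K' \<subseteq> \<Omega>" and
    R: "\<And>\<xi> p e. \<xi> \<in> K \<Longrightarrow> e \<le> 1 \<Longrightarrow>
       (\<forall>\<eta>\<in>K' \<inter> horiz_plane \<xi>. g \<xi> + p \<bullet> (Pr1 \<eta> - Pr1 \<xi>) - e \<le> g \<eta>) \<Longrightarrow> norm p \<le> R"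
    by (rule approximate_subgradients_bound[OF \<Omega> g K]) blast
  have "H_subdiff_set \<Omega> g K \<subseteq> cball 0 R"
  proof
    fix p assume "p \<in> H_subdiff_set \<Omega> g K"
    then obtain \<xi> where \<xi>: "\<xi> \<in> K" "p \<in> H_subdiff \<Omega> g \<xi>" by (auto simp: H_subdiff_set_def)
    show "p \<in> cball 0 R"
      using R[OF \<xi>(1), of 0 p] \<xi>(2) K' by (auto simp: H_subdiff_def)
  qed
  then have bounded: "bounded (H_subdiff_set \<Omega> g K)"
    using bounded_cball bounded_subset by blast
  have "closed (H_subdiff_set \<Omega> g K)"
    unfolding closed_sequential_limits
  proof (intro allI impI, elim conjE)
    fix ps p assume ps: "\<forall>n. ps n \<in> H_subdiff_set \<Omega> g K" "ps \<longlonglongrightarrow> p"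
    then have "\<forall>n. \<exists>\<xi>. \<xi> \<in> K \<and> ps n \<in> H_subdiff \<Omega> g \<xi>"
      unfolding H_subdiff_set_def by blast
    from choice[OF this]
    obtain \<xi>s where \<xi>s: "\<And>n. \<xi>s n \<in> K" "\<And>n. ps n \<in> H_subdiff \<Omega> g (\<xi>s n)"
      by blast
    obtain \<xi> r where r: "\<xi> \<in> K" "strict_mono r" "(\<xi>s \<circ> r) \<longlonglongrightarrow> \<xi>"
      using seq_compactE[OF compact_imp_seq_compact[OF K(1)], of \<xi>s] \<xi>s(1) by blast
    have "p \<in> H_subdiff \<Omega> g \<xi>"
    proof (rule H_subdiff_limit[OF \<Omega>(1) _ r(3), where es = "\<lambda>_. 0"])
      show "continuous_on \<Omega> g" using g closure_subset continuous_on_subset by blast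
      show "(ps \<circ> r) \<longlonglongrightarrow> p" using ps(2) r(2) by (rule LIMSEQ_subseq_LIMSEQ)
      fix L assume "L \<subseteq> \<Omega>"
      then show "\<forall>\<^sub>F k in sequentially. \<forall>\<eta>\<in>L \<inter> horiz_plane ((\<xi>s \<circ> r) k).
          g ((\<xi>s \<circ> r) k) + (ps \<circ> r) k \<bullet> (Pr1 \<eta> - Pr1 ((\<xi>s \<circ> r) k)) - 0 \<le> g \<eta>"
        using \<xi>s(2) by (intro always_eventually) (auto simp: H_subdiff_def)
    qed (use r K in auto)
    then show "p \<in> H_subdiff_set \<Omega> g K" using r by (auto simp: H_subdiff_set_def)
  qed
  with bounded show ?thesis by (simp add: compact_eq_bounded_closed)
qed

text \<open>An open set is a countable union of compact sets, so its image is a countable union of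
  compact sets as well.\<close>

lemma borel_H_subdiff_set_open:
  fixes \<Omega> :: "'n::finite heis set"
  assumes \<Omega>: "open \<Omega>" "bounded \<Omega>" and g: "continuous_on (closure \<Omega>) g"
    and G: "open G" "G \<subseteq> \<Omega>"
  shows "H_subdiff_set \<Omega> g G \<in> sets borel"
proof -
  obtain C where C: "\<And>n::nat. compact (C n)" "\<And>n. C n \<subseteq> G" "\<Union>(range C) = G"
    using open_Union_compact_subsets[OF G(1)] by metis
  have "compact (H_subdiff_set \<Omega> g (C n))" for n
    using C(2)[of n] G(2) by (intro compact_H_subdiff_set[OF \<Omega> g C(1)]) blast
  moreover have "H_subdiff_set \<Omega> g G = (\<Union>n. H_subdiff_set \<Omega> g (C n))"
    unfolding H_subdiff_set_def C(3)[symmetric] by blast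
  ultimately show ?thesis by (auto intro: borel_compact)
qed

section \<open>Existence of points with a prescribed horizontal subgradient\<close>

text \<open>The homotopy from \<open>f\<close> to \<open>\<lambda>x. x - x0\<close> has no zero on the frontier; a Urysohn function for the
  set of its zeros turns this into a fixed-point problem on a ball.\<close>

lemma vector_field_zero:
  fixes f :: "'a::euclidean_space \<Rightarrow> 'a"
  assumes D: "open D" "bounded D" and x0: "x0 \<in> D"
    and f: "continuous_on (closure D) f"
    and pos: "\<And>x. x \<in> frontier D \<Longrightarrow> f x \<bullet> (x - x0) > 0"
  obtains x where "x \<in> D" "f x = 0"
proof -
  have cD: "compact (closure D)" using D by simp
  define A where "A = {x \<in> closure D. \<exists>t\<in>{0..1}. t *\<^sub>R f x + (1 - t) *\<^sub>R (x - x0) = 0}"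
  \<comment> \<open>\<open>A\<close> is the projection to space of this compact set of zeros of the
    homotopy, hence closed.\<close>
  define P where "P = {p \<in> {0..1} \<times> closure D. fst p *\<^sub>R f (snd p) + (1 - fst p) *\<^sub>R (snd p - x0) = 0}"
  have "compact P"
  proof (rule closedin_compact)
    show "compact ({0..1::real} \<times> closure D)" by (intro compact_Times compact_Icc cD)
    show "closedin (top_of_set ({0..1} \<times> closure D)) P"
      unfolding P_def
      by (rule continuous_closedin_preimage_constant)
         (auto intro!: continuous_intros continuous_on_compose2[OF f])
  qed
  moreover have "A = snd ` P"
    by (force simp: A_def P_def)
  ultimately have "closed A"
    by (simp add: compact_continuous_image compact_imp_closed continuous_on_snd continuous_on_id)
  have "A \<inter> - D = {}"
  proof (rule ccontr)
    assume "A \<inter> - D \<noteq> {}"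
    then obtain x t where x: "x \<in> closure D" "x \<notin> D" "0 \<le> t" "t \<le> 1"
      and eq: "t *\<^sub>R f x + (1 - t) *\<^sub>R (x - x0) = 0"
      by (auto simp: A_def)
    have "x \<in> frontier D" using x D by (simp add: frontier_def interior_open)
    then have 1: "f x \<bullet> (x - x0) > 0" by (rule pos)
    have 2: "(x - x0) \<bullet> (x - x0) > 0" using x x0 by auto
    have "t * (f x \<bullet> (x - x0)) + (1 - t) * ((x - x0) \<bullet> (x - x0)) = 0"
      using arg_cong[OF eq, of "\<lambda>w. w \<bullet> (x - x0)"] by (simp add: inner_add_left)
    moreover have "t * (f x \<bullet> (x - x0)) + (1 - t) * ((x - x0) \<bullet> (x - x0)) > 0"
      using 1 2 x by (cases "t = 0") (auto intro!: add_pos_nonneg mult_pos_pos)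
    ultimately show False by simp
  qed
  then obtain \<phi> :: "'a \<Rightarrow> real" where \<phi>: "continuous_on UNIV \<phi>" "\<And>x. \<phi> x \<in> closed_segment 1 0"
      "\<And>x. x \<in> A \<Longrightarrow> \<phi> x = 1" "\<And>x. x \<in> - D \<Longrightarrow> \<phi> x = 0"
    using Urysohn[of A "- D" "1::real" 0] \<open>closed A\<close> D by auto
  have \<phi>01: "0 \<le> \<phi> x" "\<phi> x \<le> 1" for x
    using \<phi>(2)[of x] by (auto simp: closed_segment_eq_real_ivl)
  \<comment> \<open>The two branches agree on the frontier because \<open>\<phi>\<close> vanishes
    there. Outside \<open>D\<close> the value is \<open>x0\<close>, a point of \<open>D\<close>, so
    every fixed point lies in \<open>D\<close>.\<close>
  define k where "k x = (if x \<in> closure D then x0 + \<phi> x *\<^sub>R (x - x0 - f x) else x0)" for x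
  have k: "continuous_on UNIV k"
  proof -
    have "continuous_on (closure D \<union> - D) k"
      unfolding k_def
    proof (rule continuous_on_If)
    qed (use D \<phi> f closure_subset in \<open>auto intro!: continuous_intros intro: continuous_on_subset\<close>)
    moreover have "closure D \<union> - D = UNIV" using closure_subset by auto
    ultimately show ?thesis by simp
  qed
  have "bounded (k ` closure D)"
    using compact_continuous_image[OF continuous_on_subset[OF k] cD] compact_imp_bounded by blast
  then obtain B where B: "\<And>x. x \<in> closure D \<Longrightarrow> norm (k x) \<le> B"
    by (auto simp: bounded_iff)
  have nk: "norm (k x) \<le> max B (norm x0)" for x
    using B[of x] by (cases "x \<in> closure D") (auto simp: k_def le_max_iff_disj)
  obtain x where x: "k x = x"
  proof (rule brouwer[of "cball 0 (max B (norm x0))" k])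
    have "0 \<le> max B (norm x0)" by (simp add: le_max_iff_disj)
    then show "cball (0::'a) (max B (norm x0)) \<noteq> {}" by (metis centre_in_cball empty_iff)
  qed (use k nk in \<open>auto intro: continuous_on_subset\<close>)
  have "x \<in> D"
  proof (rule ccontr)
    assume "x \<notin> D"
    then have "k x = x0" using \<phi>(4)[of x] by (simp add: k_def)
    then show False using x x0 \<open>x \<notin> D\<close> by simp
  qed
  then have xc: "x \<in> closure D" using closure_subset by blast
  then have "x0 + \<phi> x *\<^sub>R (x - x0 - f x) = x" using x by (simp add: k_def)
  \<comment> \<open>The fixed-point equation is the homotopy equation at time
    \<open>\<phi> x\<close>. Thus \<open>x\<close> belongs to \<open>A\<close>, where
    \<open>\<phi>\<close> equals 1, and \<open>f x\<close> must vanish.\<close>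
  then have eq: "\<phi> x *\<^sub>R f x + (1 - \<phi> x) *\<^sub>R (x - x0) = 0"
    by (simp add: algebra_simps)
  then have "x \<in> A" using xc \<phi>01[of x] by (auto simp: A_def)
  then have "f x = 0" using eq \<phi>(3) by simp
  with \<open>x \<in> D\<close> show ?thesis by (rule that)
qed

text \<open>On the slice \<open>G \<inter> horiz_plane \<xi>0\<close> the field \<open>f n - p\<close> of approximate subgradients points away
  from \<open>\<xi>0\<close> along the boundary, because \<open>\<xi>0\<close> lies in the horizontal plane of every point of the
  slice. Its zeros accumulate at a point where \<open>p\<close> is an exact subgradient.\<close>

lemma H_subdiff_set_of_frontier:
  fixes \<Omega> :: "'n::finite heis set"
  assumes \<Omega>: "open \<Omega>" "bounded \<Omega>" "H_convex_set \<Omega>"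
    and g: "continuous_on (closure \<Omega>) g" "H_convex_fun (closure \<Omega>) g"
    and G: "open G" "closure G \<subseteq> \<Omega>" and \<xi>0: "\<xi>0 \<in> G"
    and fr: "\<And>\<xi>. \<xi> \<in> frontier G \<Longrightarrow> \<xi> \<in> horiz_plane \<xi>0 \<Longrightarrow> g \<xi>0 + p \<bullet> (Pr1 \<xi> - Pr1 \<xi>0) < g \<xi>"
  shows "p \<in> H_subdiff_set \<Omega> g G"
proof -
  have g\<Omega>: "continuous_on \<Omega> g" using g(1) closure_subset continuous_on_subset by blast
  have G\<Omega>: "G \<subseteq> \<Omega>" using G closure_subset by blast
  have cG: "compact (closure G)"
    using \<Omega>(2) G\<Omega> bounded_subset by auto
  obtain C f where C: "\<And>K. compact K \<Longrightarrow> K \<subseteq> \<Omega> \<Longrightarrow> \<forall>\<^sub>F n in sequentially. K \<subseteq> C n"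
    and fc: "\<And>n. continuous_on (C n) (f n)"
    and f: "\<And>n \<xi> \<eta>. \<xi> \<in> C n \<Longrightarrow> \<eta> \<in> C n \<Longrightarrow> \<eta> \<in> horiz_plane \<xi> \<Longrightarrow>
       g \<xi> + f n \<xi> \<bullet> (Pr1 \<eta> - Pr1 \<xi>) - inverse (Suc n) \<le> g \<eta>"
    by (rule subgradient_approximations[OF \<Omega> g]) blast
  define Fr where "Fr = frontier G \<inter> horiz_plane \<xi>0"
  have Fr: "compact Fr"
  proof -
    have "Fr = closure G \<inter> (frontier G \<inter> horiz_plane \<xi>0)" by (auto simp: Fr_def frontier_def)
    then show ?thesis
      using compact_Int_closed[OF cG closed_Int[OF frontier_closed closed_horiz_plane]] by simp
  qed
  \<comment> \<open>Compactness turns the strict inequality on the frontier slice into a uniform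
    margin, which beats the error \<open>inverse (Suc n)\<close> for large \<open>n\<close>. An
    empty slice takes the margin 1.\<close>
  obtain m where m: "m > 0" "\<And>\<xi>. \<xi> \<in> Fr \<Longrightarrow> m \<le> g \<xi> - (g \<xi>0 + p \<bullet> (Pr1 \<xi> - Pr1 \<xi>0))"
  proof (cases "Fr = {}")
    case False
    have "continuous_on Fr (\<lambda>\<xi>. g \<xi> - (g \<xi>0 + p \<bullet> (Pr1 \<xi> - Pr1 \<xi>0)))"
      by (intro continuous_intros continuous_on_subset[OF g\<Omega>])
         (use G in \<open>auto simp: Fr_def frontier_def\<close>)
    from continuous_attains_inf[OF Fr False this] obtain \<zeta> where "\<zeta> \<in> Fr"
      "\<forall>\<xi>\<in>Fr. g \<zeta> - (g \<xi>0 + p \<bullet> (Pr1 \<zeta> - Pr1 \<xi>0)) \<le> g \<xi> - (g \<xi>0 + p \<bullet> (Pr1 \<xi> - Pr1 \<xi>0))"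
      by blast
    then show ?thesis
      using fr[of \<zeta>] that[of "g \<zeta> - (g \<xi>0 + p \<bullet> (Pr1 \<zeta> - Pr1 \<xi>0))"] by (auto simp: Fr_def)
  qed (use that[of 1] in auto)
  \<comment> \<open>The slice of \<open>G\<close> by the plane at \<open>\<xi>0\<close>, flattened
    to an open set of projections so that the vector field lives in a Euclidean space of its own
    dimension.\<close>
  define D where "D = {z. hlift \<xi>0 z \<in> G}"
  have D: "open D"
    using open_vimage[OF G(1), of "hlift \<xi>0"] by (simp add: D_def vimage_def continuous_intros)
  have clD: "closure D \<subseteq> {z. hlift \<xi>0 z \<in> closure G}"
  proof (rule closure_minimal)
    show "D \<subseteq> {z. hlift \<xi>0 z \<in> closure G}" using closure_subset by (auto simp: D_def)
    show "closed {z. hlift \<xi>0 z \<in> closure G}"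
      using closed_vimage[OF closed_closure[of G], of "hlift \<xi>0"] by (simp add: vimage_def continuous_intros)
  qed
  have "D \<subseteq> Pr1 ` closure G"
  proof
    fix z assume "z \<in> D"
    then have "hlift \<xi>0 z \<in> closure G" using closure_subset by (auto simp: D_def)
    then show "z \<in> Pr1 ` closure G" by (metis Pr1_hlift imageI)
  qed
  moreover have "compact (Pr1 ` closure G)"
    by (intro compact_continuous_image continuous_intros cG)
  ultimately have bD: "bounded D" using bounded_subset compact_imp_bounded by blast
  have zero: "\<exists>\<xi>\<in>G \<inter> horiz_plane \<xi>0. f n \<xi> = p" if n: "closure G \<subseteq> C n" "inverse (Suc n) < m" for n
  proof -
    have cont: "continuous_on (closure D) (\<lambda>z. f n (hlift \<xi>0 z) - p)"
      using clD n by (auto intro!: continuous_intros continuous_on_compose2[OF fc])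
    have pos: "(f n (hlift \<xi>0 z) - p) \<bullet> (z - Pr1 \<xi>0) > 0" if z: "z \<in> frontier D" for z
    proof -
      let ?\<xi> = "hlift \<xi>0 z"
      have cl: "?\<xi> \<in> closure G" using z clD by (auto simp: frontier_def)
      moreover have "?\<xi> \<notin> G" using z D by (auto simp: frontier_def interior_open D_def)
      ultimately have "?\<xi> \<in> Fr" using G by (simp add: Fr_def frontier_def interior_open)
      moreover have "\<xi>0 \<in> closure G" using \<xi>0 closure_subset by blast
      then have "g ?\<xi> + f n ?\<xi> \<bullet> (Pr1 \<xi>0 - z) - inverse (Suc n) \<le> g \<xi>0"
        using f[of ?\<xi> n \<xi>0] n cl horiz_plane_sym[of \<xi>0 ?\<xi>] by auto
      ultimately show ?thesis using m(2)[of ?\<xi>] n(2)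
        by (simp add: inner_diff_left inner_diff_right)
    qed
    have "Pr1 \<xi>0 \<in> D" using \<xi>0 by (simp add: D_def)
    from vector_field_zero[OF D bD this cont pos]
    obtain z where "z \<in> D" "f n (hlift \<xi>0 z) - p = 0" by blast
    then show ?thesis by (intro bexI[of _ "hlift \<xi>0 z"]) (auto simp: D_def)
  qed
  have "\<forall>\<^sub>F n in sequentially. inverse (real (Suc n)) < m"
    by (rule order_tendstoD(2)[OF LIMSEQ_inverse_real_of_nat m(1)])
  with C[OF cG G(2)] have "\<forall>\<^sub>F n in sequentially. \<exists>\<xi>\<in>G \<inter> horiz_plane \<xi>0. f n \<xi> = p"
    by eventually_elim (rule zero)
  then obtain N where "\<And>n. n \<ge> N \<Longrightarrow> \<exists>\<xi>\<in>G \<inter> horiz_plane \<xi>0. f n \<xi> = p"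
    by (auto simp: eventually_sequentially)
  then have "\<forall>n. \<exists>\<xi>. \<xi> \<in> G \<and> \<xi> \<in> horiz_plane \<xi>0 \<and> f (n + N) \<xi> = p"
    using le_add2 by blast
  from choice[OF this]
  obtain \<xi>s where \<xi>s: "\<And>n. \<xi>s n \<in> G" "\<And>n. \<xi>s n \<in> horiz_plane \<xi>0" "\<And>n. f (n + N) (\<xi>s n) = p"
    by blast
  obtain \<xi> r where r: "\<xi> \<in> closure G" "strict_mono r" "(\<xi>s \<circ> r) \<longlonglongrightarrow> \<xi>"
    using seq_compactE[OF compact_imp_seq_compact[OF cG], of \<xi>s] \<xi>s(1) closure_subset by blast
  have filt: "filterlim (\<lambda>k. r k + N) sequentially sequentially"
    by (rule filterlim_compose[OF filterlim_add_const_nat_at_top filterlim_subseq[OF r(2)]])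
  have p: "p \<in> H_subdiff \<Omega> g \<xi>"
  proof (rule H_subdiff_limit[OF \<Omega>(1) g\<Omega> r(3), where ps = "\<lambda>_. p" and es = "\<lambda>k. inverse (Suc (r k + N))"])
    show "(\<lambda>k. inverse (real (Suc (r k + N)))) \<longlonglongrightarrow> 0"
      by (rule filterlim_compose[OF LIMSEQ_inverse_real_of_nat filt])
    fix K :: "'n heis set" assume K: "compact K" "K \<subseteq> \<Omega>"
    have "\<forall>\<^sub>F n in sequentially. closure G \<subseteq> C n \<and> K \<subseteq> C n"
      using C[OF K] C[OF cG G(2)] by eventually_elim auto
    from eventually_compose_filterlim[OF this filt]
    show "\<forall>\<^sub>F k in sequentially. \<forall>\<eta>\<in>K \<inter> horiz_plane ((\<xi>s \<circ> r) k).
        g ((\<xi>s \<circ> r) k) + p \<bullet> (Pr1 \<eta> - Pr1 ((\<xi>s \<circ> r) k)) - inverse (Suc (r k + N)) \<le> g \<eta>"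
    proof eventually_elim
      case (elim k)
      have "\<xi>s (r k) \<in> C (r k + N)" using elim \<xi>s(1) closure_subset by blast
      then show ?case using elim f[of "\<xi>s (r k)" "r k + N"] \<xi>s(3)[of "r k"] by auto
    qed
  qed (use r G in auto)
  have \<xi>h: "\<xi> \<in> horiz_plane \<xi>0"
    by (rule closed_sequentially[OF closed_horiz_plane _ r(3)]) (use \<xi>s in auto)
  \<comment> \<open>The limit is so far known only to lie in the closure. On the frontier, the
    subgradient inequality at \<xi> tested at \<open>\<xi>0\<close> would contradict the strict
    inequality assumed there.\<close>
  have "\<xi> \<in> G"
  proof (rule ccontr)
    assume "\<xi> \<notin> G"
    then have "\<xi> \<in> frontier G" using r G by (simp add: frontier_def interior_open)
    from fr[OF this \<xi>h] have "g \<xi>0 + p \<bullet> (Pr1 \<xi> - Pr1 \<xi>0) < g \<xi>" .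
    moreover have "g \<xi> + p \<bullet> (Pr1 \<xi>0 - Pr1 \<xi>) \<le> g \<xi>0"
      using p \<xi>h \<xi>0 G\<Omega> horiz_plane_sym unfolding H_subdiff_def by blast
    ultimately show False by (simp add: inner_diff_right)
  qed
  with p show ?thesis by (auto simp: H_subdiff_set_def)
qed

section \<open>Comparison principle\<close>

lemma H_subdiff_scale_add:
  assumes "p \<in> H_subdiff \<Omega> u \<xi>" "0 \<le> k"
  shows "k *\<^sub>R p \<in> H_subdiff \<Omega> (\<lambda>\<xi>. k * u \<xi> + c) \<xi>"
  unfolding H_subdiff_def
proof (intro CollectI ballI)
  fix \<eta> assume "\<eta> \<in> \<Omega> \<inter> horiz_plane \<xi>"
  then have "k * (u \<xi> + p \<bullet> (Pr1 \<eta> - Pr1 \<xi>)) \<le> k * u \<eta>"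
    using assms by (intro mult_left_mono) (auto simp: H_subdiff_def)
  then show "k * u \<xi> + c + k *\<^sub>R p \<bullet> (Pr1 \<eta> - Pr1 \<xi>) \<le> k * u \<eta> + c"
    by (simp add: distrib_left)
qed

text \<open>The plane of slope \<open>p\<close> starting at \<open>v \<xi>\<close> lies below
  \<open>w\<close>, hence below \<open>v\<close>, on the frontier slice with room
  \<open>w \<xi> - v \<xi>\<close>. This room absorbs a small change of slope.\<close>

lemma H_subdiff_in_H_subdiff_set:
  fixes \<Omega> :: "'n::finite heis set"
  assumes \<Omega>: "open \<Omega>" "bounded \<Omega>" "H_convex_set \<Omega>"
    and v: "continuous_on (closure \<Omega>) v" "H_convex_fun (closure \<Omega>) v"
    and G: "open G" "closure G \<subseteq> \<Omega>" and \<xi>: "\<xi> \<in> G"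
    and le: "\<And>\<eta>. \<eta> \<in> frontier G \<Longrightarrow> w \<eta> \<le> v \<eta>" and less: "v \<xi> < w \<xi>"
    and p: "p \<in> H_subdiff \<Omega> w \<xi>"
  obtains \<delta> where "\<delta> > 0" "ball p \<delta> \<subseteq> H_subdiff_set \<Omega> v G"
proof -
  obtain R where R: "R > 0" "\<And>\<eta>. \<eta> \<in> \<Omega> \<Longrightarrow> norm \<eta> \<le> R"
    using \<Omega>(2) by (auto simp: bounded_pos simp del: split_paired_All)
  \<comment> \<open>Projections of points of \<Omega> differ by at most \<open>2 * R\<close>, so a
    change of slope below \<open>\<delta>\<close> changes the affine function by less than the
    gap.\<close>
  define \<delta> where "\<delta> = (w \<xi> - v \<xi>) / (2 * R)"
  have \<delta>: "\<delta> > 0" using R less by (simp add: \<delta>_def)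
  moreover have "p' \<in> H_subdiff_set \<Omega> v G" if "p' \<in> ball p \<delta>" for p'
  proof (rule H_subdiff_set_of_frontier[OF \<Omega> v G \<xi>])
    fix \<eta> assume \<eta>: "\<eta> \<in> frontier G" "\<eta> \<in> horiz_plane \<xi>"
    have in\<Omega>: "\<eta> \<in> \<Omega>" "\<xi> \<in> \<Omega>" using \<eta> G \<xi> closure_subset by (auto simp: frontier_def)
    have "norm (Pr1 \<eta> - Pr1 \<xi>) \<le> norm \<eta> + norm \<xi>"
      using norm_triangle_ineq4[of "Pr1 \<eta>" "Pr1 \<xi>"] norm_Pr1_le[of \<eta>] norm_Pr1_le[of \<xi>] by linarith
    then have "norm (Pr1 \<eta> - Pr1 \<xi>) \<le> 2 * R" using R(2)[OF in\<Omega>(1)] R(2)[OF in\<Omega>(2)] by linarith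
    then have "norm (p' - p) * norm (Pr1 \<eta> - Pr1 \<xi>) \<le> norm (p' - p) * (2 * R)"
      by (rule mult_left_mono) simp
    also have "\<dots> < \<delta> * (2 * R)"
      using that R(1) by (intro mult_strict_right_mono) (auto simp: dist_norm norm_minus_commute)
    also have "\<dots> = w \<xi> - v \<xi>" using R(1) by (simp add: \<delta>_def)
    finally have "(p' - p) \<bullet> (Pr1 \<eta> - Pr1 \<xi>) < w \<xi> - v \<xi>"
      using norm_cauchy_schwarz[of "p' - p" "Pr1 \<eta> - Pr1 \<xi>"] by linarith
    moreover have "w \<xi> + p \<bullet> (Pr1 \<eta> - Pr1 \<xi>) \<le> w \<eta>"
      using p in\<Omega> \<eta> by (auto simp: H_subdiff_def)
    ultimately show "v \<xi> + p' \<bullet> (Pr1 \<eta> - Pr1 \<xi>) < v \<eta>"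
      using le[OF \<eta>(1)] by (simp add: inner_diff_left)
  qed
  ultimately show ?thesis by (intro that[of \<delta>]) auto
qed

theorem theorem1p2:
  fixes \<Omega> :: "'n::finite heis set" and u v :: "'n heis \<Rightarrow> real"
  assumes "open \<Omega>" and "bounded \<Omega>" and "H_convex_set \<Omega>"
    and "continuous_on (closure \<Omega>) u" and "continuous_on (closure \<Omega>) v"
    and "H_convex_fun (closure \<Omega>) u" and "H_convex_fun (closure \<Omega>) v"
    and "\<And>E. E \<in> sets borel \<Longrightarrow> E \<subseteq> \<Omega> \<Longrightarrow>
           emeasure lebesgue (H_subdiff_set \<Omega> v E) \<le> emeasure lebesgue (H_subdiff_set \<Omega> u E)"
  shows "(INF \<xi>\<in>closure \<Omega>. v \<xi> - u \<xi>) = (INF \<xi>\<in>frontier \<Omega>. v \<xi> - u \<xi>)"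
proof (cases "\<Omega> = {}")
  case False
  note \<Omega> = assms(1-3) and u = assms(4,6) and v = assms(5,7)
  have c\<Omega>: "compact (closure \<Omega>)" using \<Omega> by simp
  have ne: "closure \<Omega> \<noteq> {}" using False by simp
  have sub: "frontier \<Omega> \<subseteq> closure \<Omega>" by (simp add: frontier_def)
  \<comment> \<open>A nonempty frontier makes the right-hand infimum range over a nonempty
    set.\<close>
  have "\<Omega> \<noteq> UNIV" using \<Omega>(2) not_bounded_UNIV by auto
  then have frne: "frontier \<Omega> \<noteq> {}" using False frontier_eq_empty by blast
  have contd: "continuous_on (closure \<Omega>) (\<lambda>\<xi>. v \<xi> - u \<xi>)"
    by (intro continuous_intros u v)
  then obtain \<xi>m where \<xi>m: "\<xi>m \<in> closure \<Omega>" "\<And>\<xi>. \<xi> \<in> closure \<Omega> \<Longrightarrow> v \<xi>m - u \<xi>m \<le> v \<xi> - u \<xi>"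
    using continuous_attains_inf[OF c\<Omega> ne contd] by blast
  define m M where "m = v \<xi>m - u \<xi>m" and "M = (INF \<xi>\<in>frontier \<Omega>. v \<xi> - u \<xi>)"
  have bdd: "bdd_below ((\<lambda>\<xi>. v \<xi> - u \<xi>) ` closure \<Omega>)"
    by (rule bdd_belowI2[of _ m]) (simp add: m_def \<xi>m)
  have INFm: "(INF \<xi>\<in>closure \<Omega>. v \<xi> - u \<xi>) = m"
    unfolding m_def by (rule cInf_eq_minimum) (use \<xi>m in auto)
  have mM: "m \<le> M"
    unfolding M_def INFm[symmetric] by (rule cINF_superset_mono[OF frne bdd sub]) simp
  have M: "M \<le> v \<xi> - u \<xi>" if "\<xi> \<in> frontier \<Omega>" for \<xi>
    unfolding M_def by (rule cINF_lower[OF bdd_below_mono[OF bdd image_mono[OF sub]] that])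
  have "\<not> m < M"
  proof
    assume less: "m < M"
    have "bounded (u ` closure \<Omega>)"
      using compact_continuous_image[OF u(1) c\<Omega>] compact_imp_bounded by blast
    then obtain B where B: "B > 0" "\<And>x. x \<in> closure \<Omega> \<Longrightarrow> \<bar>u x\<bar> \<le> B"
      unfolding bounded_pos by (metis imageI real_norm_def)
    \<comment> \<open>\<open>c\<close> is at distance \<open>(M - m) / 2\<close> from both
      \<open>m\<close> and \<open>M\<close>, and \<open>\<epsilon> * u\<close> is at most half of
      that. So \<open>w\<close> stays below \<open>v\<close> on the frontier of \<Omega> but above
      \<open>v\<close> at \<open>\<xi>m\<close>.\<close>
    define \<epsilon> c where "\<epsilon> = (M - m) / (4 * B)" and "c = (m + M) / 2"
    have \<epsilon>: "\<epsilon> > 0" using less B by (simp add: \<epsilon>_def)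
    have \<epsilon>u: "\<bar>\<epsilon> * u x\<bar> \<le> (M - m) / 4" if "x \<in> closure \<Omega>" for x
    proof -
      have "\<bar>\<epsilon> * u x\<bar> \<le> \<epsilon> * B" using B(2)[OF that] \<epsilon> by (simp add: abs_mult)
      also have "\<dots> = (M - m) / 4" using B(1) by (simp add: \<epsilon>_def)
      finally show ?thesis .
    qed
    define w where "w x = (1 + \<epsilon>) * u x + c" for x
    have w_eq: "w x = u x + \<epsilon> * u x + (m + M) / 2" for x
      by (simp add: w_def c_def distrib_right)
    have w: "continuous_on (closure \<Omega>) w"
      unfolding w_def by (intro continuous_intros u)
    have wfr: "w \<xi> < v \<xi>" if "\<xi> \<in> frontier \<Omega>" for \<xi>
    proof -
      have "\<xi> \<in> closure \<Omega>" using that sub by blast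
      have "x + t + (m + M) / 2 < y" if "t \<le> (M - m) / 4" "M \<le> y - x" for x y t
        using that less by (simp add: field_simps)
      from this[OF abs_le_D1[OF \<epsilon>u[OF \<open>\<xi> \<in> closure \<Omega>\<close>]] M[OF that]] show ?thesis
        by (simp only: w_eq)
    qed
    have wm: "v \<xi>m < w \<xi>m"
    proof -
      have "x + m < x + t + (m + M) / 2" if "- t \<le> (M - m) / 4" for x t
        using that less by (simp add: field_simps)
      from this[OF abs_le_D2[OF \<epsilon>u[OF \<xi>m(1)]], of "u \<xi>m"] show ?thesis
        by (simp add: w_eq m_def)
    qed
    define G where "G = {\<xi> \<in> \<Omega>. v \<xi> < w \<xi>}"
    have G: "open G"
    proof -
      obtain A where "open A" "A \<inter> \<Omega> = G"
        using open_Collect_less_Int[OF continuous_on_subset[OF v(1) closure_subset]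
            continuous_on_subset[OF w closure_subset]] unfolding G_def by blast
      then show ?thesis using \<Omega>(1) open_Int by blast
    qed
    have clG: "closure G \<subseteq> {\<xi> \<in> closure \<Omega>. v \<xi> \<le> w \<xi>}"
    proof (rule closure_minimal)
      show "G \<subseteq> {\<xi> \<in> closure \<Omega>. v \<xi> \<le> w \<xi>}" using closure_subset by (auto simp: G_def)
      show "closed {\<xi> \<in> closure \<Omega>. v \<xi> \<le> w \<xi>}"
        by (rule continuous_on_closed_Collect_le[OF v(1) w]) simp
    qed
    have clG\<Omega>: "closure G \<subseteq> \<Omega>"
    proof
      fix \<xi> assume "\<xi> \<in> closure G"
      then have "\<xi> \<in> closure \<Omega>" "v \<xi> \<le> w \<xi>" using clG by auto
      then show "\<xi> \<in> \<Omega>" using wfr[of \<xi>] \<Omega>(1) by (auto simp: frontier_def interior_open)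
    qed
    have frG: "w \<eta> \<le> v \<eta>" if "\<eta> \<in> frontier G" for \<eta>
    proof -
      have "\<eta> \<in> \<Omega>" "\<eta> \<notin> G" using that clG\<Omega> G by (auto simp: frontier_def interior_open)
      then show ?thesis by (simp add: G_def)
    qed
    have "\<xi>m \<in> \<Omega>" using wfr[of \<xi>m] wm \<xi>m(1) \<Omega>(1) by (auto simp: frontier_def interior_open)
    then have \<xi>mG: "\<xi>m \<in> G" using wm by (simp add: G_def)
    have G\<Omega>: "G \<subseteq> \<Omega>" by (auto simp: G_def)
    have balls: "\<exists>\<delta>>0. ball ((1 + \<epsilon>) *\<^sub>R p) \<delta> \<subseteq> H_subdiff_set \<Omega> v G"
      if \<xi>: "\<xi> \<in> G" and p: "p \<in> H_subdiff \<Omega> u \<xi>" for \<xi> p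
    proof -
      have pw: "(1 + \<epsilon>) *\<^sub>R p \<in> H_subdiff \<Omega> w \<xi>"
        using H_subdiff_scale_add[OF p, of "1 + \<epsilon>" c] \<epsilon> by (simp add: w_def[abs_def])
      have "v \<xi> < w \<xi>" using \<xi> by (simp add: G_def)
      from H_subdiff_in_H_subdiff_set[OF \<Omega> v G clG\<Omega> \<xi> frG this pw] show ?thesis by blast
    qed
    let ?U = "H_subdiff_set \<Omega> u G" and ?V = "H_subdiff_set \<Omega> v G"
    let ?N = "DIM((real^'n) \<times> (real^'n))"
    have V: "?V \<in> sets lebesgue"
      using borel_H_subdiff_set_open[OF \<Omega>(1,2) v(1) G G\<Omega>] by auto
    \<comment> \<open>The summand 0 puts the dilation in the shape of an affine map, as in
      \<open>emeasure_lebesgue_affine\<close>.\<close>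
    have "(\<lambda>p. (1 + \<epsilon>) *\<^sub>R p + 0) ` ?U \<subseteq> ?V"
    proof
      fix q assume "q \<in> (\<lambda>p. (1 + \<epsilon>) *\<^sub>R p + 0) ` ?U"
      then obtain \<xi> p where "\<xi> \<in> G" "p \<in> H_subdiff \<Omega> u \<xi>" and q: "q = (1 + \<epsilon>) *\<^sub>R p"
        by (auto simp: H_subdiff_set_def)
      from balls[OF this(1,2)] obtain \<delta> where "\<delta> > 0" "ball q \<delta> \<subseteq> ?V" by (auto simp: q)
      then show "q \<in> ?V" by (meson centre_in_ball subsetD)
    qed
    then have "emeasure lebesgue ((\<lambda>p. (1 + \<epsilon>) *\<^sub>R p + 0) ` ?U) \<le> emeasure lebesgue ?V"
      by (rule emeasure_mono[OF _ V])
    then have scaled: "ennreal ((1 + \<epsilon>) ^ ?N) * emeasure lebesgue ?U \<le> emeasure lebesgue ?V"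
      using \<epsilon> emeasure_lebesgue_affine[of "1 + \<epsilon>" 0 ?U] by (simp add: ennreal_power)
    have VU: "emeasure lebesgue ?V \<le> emeasure lebesgue ?U"
      by (rule assms(8)) (use G G\<Omega> in auto)
    \<comment> \<open>Finiteness is what lets the strict expansion factor force the measure to be 0.
      It holds because the closure of \<open>G\<close> is a compact subset of \<Omega>.\<close>
    have "emeasure lebesgue ?U \<noteq> \<infinity>"
    proof -
      have "compact (H_subdiff_set \<Omega> u (closure G))"
        by (rule compact_H_subdiff_set[OF \<Omega>(1,2) u(1) _ clG\<Omega>])
           (use \<Omega>(2) G\<Omega> bounded_subset in auto)
      then have "H_subdiff_set \<Omega> u (closure G) \<in> lmeasurable" by (rule lmeasurable_compact)
      then have fin: "emeasure lebesgue (H_subdiff_set \<Omega> u (closure G)) < \<infinity>"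
        and "H_subdiff_set \<Omega> u (closure G) \<in> sets lebesgue"
        unfolding fmeasurable_def by blast+
      moreover have "?U \<subseteq> H_subdiff_set \<Omega> u (closure G)"
        using closure_subset unfolding H_subdiff_set_def by blast
      ultimately have "emeasure lebesgue ?U \<le> emeasure lebesgue (H_subdiff_set \<Omega> u (closure G))"
        by (intro emeasure_mono)
      from order_le_less_trans[OF this fin] show ?thesis by (rule less_imp_neq)
    qed
    then obtain r where r: "emeasure lebesgue ?U = ennreal r" "r \<ge> 0"
      by (cases "emeasure lebesgue ?U") auto
    have "(1 + \<epsilon>) ^ ?N * r \<le> r"
      using order_trans[OF scaled VU] r \<epsilon> by (simp add: ennreal_mult[symmetric] del: DIM_prod)
    moreover have "1 < (1 + \<epsilon>) ^ ?N"
      using \<epsilon> DIM_positive by (intro one_less_power) auto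
    ultimately have "r = 0"
      using r(2) by (metis less_eq_real_def mult_less_cancel_right1 not_less)
    then have "emeasure lebesgue ?V = 0" using VU r by simp
    then have neg: "negligible ?V"
      using V by (simp add: negligible_iff_null_sets null_sets_def)
    \<comment> \<open>One subgradient of \<open>u\<close> at \<open>\<xi>m\<close> already yields a
      whole ball inside \<open>?V\<close>, which contradicts negligibility.\<close>
    obtain p where "p \<in> H_subdiff \<Omega> u \<xi>m"
      using H_subdiff_nonempty[OF \<Omega> u \<open>\<xi>m \<in> \<Omega>\<close>] by blast
    from balls[OF \<xi>mG this] obtain q \<delta> where "\<delta> > 0" "ball q \<delta> \<subseteq> ?V" by blast
    then have "negligible (ball q \<delta>)" using neg negligible_subset by blast
    then show False using open_not_negligible[of "ball q \<delta>"] \<open>\<delta> > 0\<close> by simp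
  qed
  with mM show ?thesis unfolding INFm M_def[symmetric] by simp
\<comment> \<open>For empty \<Omega> both sides are the infimum over the empty set.\<close>
qed simp

end
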